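(* Let $\theta$ be a primitive bijective aperiodic substitution of constant length. If two points $x,x'\in X_\theta$ are forward (respectively backward) proximal then they are forward (respectively backward) asymptotic. Furthermore, forward and backward proximality are non-trivial (not equal to the diagonal). In particular, the Ellis semigroup $E(X_\theta)$ is completely regular and is the disjoint union of its kernel $\mathcal M(X_\theta)$ with $\mathbb Z$.
   Context: A substitution of constant length $\ell$ on a finite alphabet $\mathcal A$ is a map $\theta(a)=\theta_0(a)\cdots\theta_{\ell-1}(a)$ with maps $\theta_i:\mathcal A\to\mathcal A$, extended to words by concatenation. It is bijective if all $\theta_i$ are bijections, primitive if for some $k$ every $\theta^k(a)$ contains every letter. A word is allowed if it occurs in some $\theta^k(a)$; $X_\theta\subset\mathcal A^{\mathbb Z}$ is the space of bi-infinite sequences all of whose finite subwords are allowed, with left shift $\sigma$. $\theta$ is aperiodic if $X_\theta$ contains no $\sigma$-periodic sequence. With $d$ a metric inducing the topology, $x,x'$ are forward proximal if $\inf_{t\in\mathbb Z^+}d(\sigma^t(x),\sigma^t(x'))=0$, forward asymptotic if $\lim_{t\to+\infty}d(\sigma^t(x),\sigma^t(x'))=0$; the backward notions use $\sigma^{-1}$. $E(X_\theta)$ is the closure of $\{\sigma^t:t\in\mathbb Z\}$ in $X_\theta^{X_\theta}$ for pointwise convergence, a semigroup under composition; $\mathbb Z$ denotes $\{\sigma^t:t\in\mathbb Z\}$; the kernel is the smallest two-sided ideal. A semigroup $S$ is completely regular if for every $s\in S$ there is $t\in S$ with $sts=s$, $tst=t$, $st=ts$. *)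

theory Defs
  imports "HOL-Analysis.Analysis" "HOL-Library.Sublist"
begin

section \<open>Substitutions of constant length\<close>

text \<open>The alphabet is a finite type and \<open>\<theta>\<close> maps letters to words; its \<open>i\<close>-th column map
  is \<open>\<theta>\<^sub>i = (\<lambda>a. \<theta> a ! i)\<close> for \<open>i < L\<close>.
  Lengths \<open>L \<le> 1\<close> are excluded where it matters: a primitive such \<open>\<theta>\<close> lives on a
  one-letter alphabet and its \<open>subst_space\<close> is empty.\<close>

definition constant_length :: "('a \<Rightarrow> 'a list) \<Rightarrow> nat \<Rightarrow> bool" where
  "constant_length \<theta> L \<longleftrightarrow> (\<forall>a. length (\<theta> a) = L)"

definition bijective_subst :: "('a \<Rightarrow> 'a list) \<Rightarrow> nat \<Rightarrow> bool" where
  "bijective_subst \<theta> L \<longleftrightarrow> (\<forall>i<L. bij (\<lambda>a. \<theta> a ! i))"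

definition extend :: "('a \<Rightarrow> 'a list) \<Rightarrow> 'a list \<Rightarrow> 'a list" where
  "extend \<theta> w = concat (map \<theta> w)"

definition subst_power :: "('a \<Rightarrow> 'a list) \<Rightarrow> nat \<Rightarrow> 'a \<Rightarrow> 'a list" where
  "subst_power \<theta> k a = (extend \<theta> ^^ k) [a]"

definition primitive_subst :: "('a \<Rightarrow> 'a list) \<Rightarrow> bool" where
  "primitive_subst \<theta> \<longleftrightarrow> (\<exists>k. \<forall>a b. b \<in> set (subst_power \<theta> k a))"

definition allowed :: "('a \<Rightarrow> 'a list) \<Rightarrow> 'a list \<Rightarrow> bool" where
  "allowed \<theta> w \<longleftrightarrow> (\<exists>k a. sublist w (subst_power \<theta> k a))"

definition subst_space :: "('a \<Rightarrow> 'a list) \<Rightarrow> (int \<Rightarrow> 'a) set" where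
  "subst_space \<theta> = {x. \<forall>m n. allowed \<theta> (map x [m..n])}"

text \<open>\<open>shift t\<close> is the \<open>t\<close>-th power of the left shift \<open>\<sigma> = shift 1\<close>, for any integer \<open>t\<close>;
  the lemmas below justify this.\<close>

definition shift :: "int \<Rightarrow> (int \<Rightarrow> 'a) \<Rightarrow> (int \<Rightarrow> 'a)" where
  "shift t x = (\<lambda>n. x (n + t))"

lemma shift_0: "shift 0 x = x"
  by (simp add: shift_def)

lemma shift_shift: "shift s (shift t x) = shift (s + t) x"
  by (simp add: shift_def algebra_simps)

lemma shift_funpow: "(shift 1 ^^ k) x = shift (int k) x"
  by (induction k arbitrary: x) (simp_all add: shift_0 shift_shift algebra_simps)

lemma shift_in_subst_space:
  assumes "x \<in> subst_space \<theta>"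
  shows "shift t x \<in> subst_space \<theta>"
proof -
  have "map (shift t x) [m..n] = map x [m + t..n + t]" for m n
    by (rule nth_equalityI) (simp_all add: shift_def algebra_simps)
  then show ?thesis
    using assms by (simp add: subst_space_def)
qed

definition aperiodic_subst :: "('a \<Rightarrow> 'a list) \<Rightarrow> bool" where
  "aperiodic_subst \<theta> \<longleftrightarrow> \<not> (\<exists>x\<in>subst_space \<theta>. \<exists>p>0. shift p x = x)"

definition subst_topology :: "('a \<Rightarrow> 'a list) \<Rightarrow> (int \<Rightarrow> 'a) topology" where
  "subst_topology \<theta> =
     subtopology (product_topology (\<lambda>_. discrete_topology UNIV) UNIV) (subst_space \<theta>)"

lemma topspace_subst_topology: "topspace (subst_topology \<theta>) = subst_space \<theta>"
  by (simp add: subst_topology_def)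

section \<open>Proximality and asymptoticity\<close>

definition induces_subst_topology ::
  "('a \<Rightarrow> 'a list) \<Rightarrow> ((int \<Rightarrow> 'a) \<Rightarrow> (int \<Rightarrow> 'a) \<Rightarrow> real) \<Rightarrow> bool" where
  "induces_subst_topology \<theta> d \<longleftrightarrow>
     Metric_space (subst_space \<theta>) d \<and>
     Metric_space.mtopology (subst_space \<theta>) d = subst_topology \<theta>"

text \<open>Such a metric always exists.\<close>

lemma ex_induces_subst_topology: "\<exists>d. induces_subst_topology \<theta> d"
proof -
  have "metrizable_space (subst_topology \<theta>)"
    unfolding subst_topology_def
    by (intro metrizable_space_subtopology)
       (auto simp: metrizable_space_product_topology metrizable_space_discrete_topology)
  then obtain M d where "Metric_space M d" "subst_topology \<theta> = Metric_space.mtopology M d"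
    unfolding metrizable_space_def by blast
  moreover from this have "M = subst_space \<theta>"
    by (metis Metric_space.topspace_mtopology topspace_subst_topology)
  ultimately show ?thesis
    unfolding induces_subst_topology_def by auto
qed

definition forward_proximal where
  "forward_proximal d x x' \<longleftrightarrow> (INF t::nat. d (shift (int t) x) (shift (int t) x') :: real) = 0"

definition backward_proximal where
  "backward_proximal d x x' \<longleftrightarrow> (INF t::nat. d (shift (- int t) x) (shift (- int t) x') :: real) = 0"

definition forward_asymptotic where
  "forward_asymptotic d x x' \<longleftrightarrow>
     (\<lambda>t::nat. d (shift (int t) x) (shift (int t) x') :: real) \<longlonglongrightarrow> 0"

definition backward_asymptotic where
  "backward_asymptotic d x x' \<longleftrightarrow>
     (\<lambda>t::nat. d (shift (- int t) x) (shift (- int t) x') :: real) \<longlonglongrightarrow> 0"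

section \<open>Semigroups on a carrier set\<close>

definition semigroup_on :: "'s set \<Rightarrow> ('s \<Rightarrow> 's \<Rightarrow> 's) \<Rightarrow> bool" where
  "semigroup_on S m \<longleftrightarrow>
     (\<forall>s\<in>S. \<forall>t\<in>S. m s t \<in> S) \<and>
     (\<forall>s\<in>S. \<forall>t\<in>S. \<forall>u\<in>S. m (m s t) u = m s (m t u))"

definition completely_regular_semigroup :: "'s set \<Rightarrow> ('s \<Rightarrow> 's \<Rightarrow> 's) \<Rightarrow> bool" where
  "completely_regular_semigroup S m \<longleftrightarrow> semigroup_on S m \<and>
     (\<forall>s\<in>S. \<exists>t\<in>S. m (m s t) s = s \<and> m (m t s) t = t \<and> m s t = m t s)"

definition two_sided_ideal :: "'s set \<Rightarrow> ('s \<Rightarrow> 's \<Rightarrow> 's) \<Rightarrow> 's set \<Rightarrow> bool" where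
  "two_sided_ideal S m I \<longleftrightarrow>
     I \<noteq> {} \<and> I \<subseteq> S \<and> (\<forall>s\<in>S. \<forall>i\<in>I. m s i \<in> I \<and> m i s \<in> I)"

definition is_kernel :: "'s set \<Rightarrow> ('s \<Rightarrow> 's \<Rightarrow> 's) \<Rightarrow> 's set \<Rightarrow> bool" where
  "is_kernel S m M \<longleftrightarrow> two_sided_ideal S m M \<and> (\<forall>I. two_sided_ideal S m I \<longrightarrow> M \<subseteq> I)"

section \<open>The Ellis semigroup\<close>

text \<open>Self-maps of \<open>X\<^sub>\<theta>\<close> are represented extensionally, as elements of
  \<open>subst_space \<theta> \<rightarrow>\<^sub>E subst_space \<theta>\<close>, the underlying set of the product topology below.
  Accordingly, composition of self-maps is \<open>compose (subst_space \<theta>)\<close>.\<close>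

definition shift_maps :: "('a \<Rightarrow> 'a list) \<Rightarrow> ((int \<Rightarrow> 'a) \<Rightarrow> (int \<Rightarrow> 'a)) set" where
  "shift_maps \<theta> = range (\<lambda>t. restrict (shift t) (subst_space \<theta>))"

definition Ellis :: "('a \<Rightarrow> 'a list) \<Rightarrow> ((int \<Rightarrow> 'a) \<Rightarrow> (int \<Rightarrow> 'a)) set" where
  "Ellis \<theta> =
     product_topology (\<lambda>_. subst_topology \<theta>) (subst_space \<theta>) closure_of shift_maps \<theta>"

end

theory Submission
  imports Defs
begin

text \<open>If two points agree on arbitrarily long windows, then for every \<open>n\<close> their decompositions into
  blocks \<open>\<theta>\<^sup>n(a)\<close> are cut at the same places, and since the columns of \<open>\<theta>\<^sup>n\<close> are bijective, agreement
  at one place of a block forces agreement on the whole block. Letting \<open>n\<close> grow, the set of places where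
  the two points agree is an interval. Hence forward proximal points are forward asymptotic, and points
  that are asymptotic in both directions are equal.

  Let \<open>S\<close> be the set of limits of the shifts \<open>\<sigma>\<^sup>t\<close> as \<open>t \<rightarrow> \<infinity>\<close>. Every \<open>f \<in> S\<close> identifies exactly the
  forward asymptotic pairs, so \<open>f u = f\<close> for each idempotent \<open>u \<in> S\<close>. Together with the
  Ellis--Numakura lemma this makes \<open>S\<close> left simple with idempotents, hence completely regular;
  the same holds for \<open>t \<rightarrow> - \<infinity>\<close>. Since nontrivial asymptotic pairs exist, the elements of these two
  semigroups are exactly the non-injective elements of the Ellis semigroup, that is, those that are
  not shifts. An ideal meets both, because a product with a right factor from one of them identifies
  the asymptotic pairs of that direction, and contains both by left simplicity.\<close>

section \<open>Blocks and desubstitution\<close>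

text \<open>That blocks are cut at the same places is recognizability, and here aperiodicity enters.
  Two points that agree on long windows although their cuts are offset by k force the shift by k to
  map \<theta>^n(X) into itself: recurrence spreads the coincidence over all of X, and \<theta>^n(X)
  is closed. If L^n does not divide k, peeling off levels leaves some 0 < k < L with \<theta>(X)
  invariant under the shift by k. At level n this yields invariance under k^n, exponentially smaller
  than L^n, whereas words of length L^n recur with gaps only proportional to L^n. A repetition
  inside one block then becomes a period of a whole point. The existence of asymptotic pairs rests
  on the same obstruction: without them a half line would be periodic.

  On the algebraic side, composition is continuous in its left factor only. Hence the left ideals
  \<open>S f\<close> are the compact ones, and idempotents are sought there; they act as right
  identities because they move a point only within its asymptotic class.\<close>

lemma nth_concat_const:
  assumes "\<forall>v\<in>set vs. length v = m" "r < m * length vs"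
  shows "concat vs ! r = vs ! (r div m) ! (r mod m)"
  using assms
proof (induction vs arbitrary: r)
  case (Cons v vs)
  show ?case
  proof (cases "r < m")
    case True
    then show ?thesis using Cons.prems by (simp add: nth_append)
  next
    case False
    then have "r = m + (r - m)" "0 < m" using Cons.prems by auto
    then have "r div m = Suc ((r - m) div m)" "r mod m = (r - m) mod m"
      by (metis div_add_self1 less_numeral_extra(3) plus_1_eq_Suc add.commute, metis mod_add_self1)
    moreover have "concat vs ! (r - m) = vs ! ((r - m) div m) ! ((r - m) mod m)"
      using Cons False by (intro Cons.IH) auto
    ultimately show ?thesis using False Cons.prems by (simp add: nth_append)
  qed
qed simp

lemma extend_funpow: "(extend \<theta> ^^ n) w = concat (map (subst_power \<theta> n) w)"
proof -
  have app: "(extend \<theta> ^^ n) (u @ v) = (extend \<theta> ^^ n) u @ (extend \<theta> ^^ n) v" for u v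
    by (induction n) (simp_all add: extend_def)
  have nil: "(extend \<theta> ^^ n) [] = []"
    by (induction n) (simp_all add: extend_def)
  show ?thesis
  proof (induction w)
    case (Cons a w)
    then show ?case using app[of "[a]" w] by (simp add: subst_power_def)
  qed (simp add: nil)
qed

lemma zdiv_less_iff:
  fixes a b c :: int
  assumes "0 < c"
  shows "a div c < b \<longleftrightarrow> a < b * c"
proof
  assume "a div c < b"
  then have "(a div c) * c \<le> (b - 1) * c" using assms by (intro mult_right_mono) auto
  moreover have "a = (a div c) * c + a mod c" "a mod c < c" using assms by simp_all
  moreover have "(b - 1) * c = b * c - c" by (simp add: left_diff_distrib)
  ultimately show "a < b * c" by linarith
next
  assume *: "a < b * c"
  show "a div c < b"
  proof (rule ccontr)
    assume "\<not> a div c < b"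
    then have "b * c \<le> (a div c) * c" using assms by (intro mult_right_mono) auto
    moreover have "a = (a div c) * c + a mod c" "0 \<le> a mod c" using assms by simp_all
    ultimately show False using * by linarith
  qed
qed

text \<open>Compares shifts of size \<open>k ^ n\<close> with blocks of length \<open>L ^ n\<close>:
  \<open>d\<close> will be the number of letters and \<open>c\<close> a fixed power of
  \<open>L\<close> that absorbs the recurrence constant.\<close>

lemma eventually_power_dominates:
  fixes k L d c :: nat
  assumes "k < L"
  shows "\<exists>n\<ge>m. d * k ^ n * c \<le> L ^ n"
proof (cases "k = 0")
  case True
  then show ?thesis using assms by (intro exI[of _ "Suc m"]) (simp add: power_0_left)
next
  case False
  then have "1 < real L / real k" using assms by simp
  then obtain n0 where n0: "real (d * c) < (real L / real k) ^ n0" using real_arch_pow by blast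
  define n where "n = max n0 m"
  have "real (d * c) \<le> (real L / real k) ^ n"
    using n0 power_increasing[of n0 n "real L / real k"] \<open>1 < real L / real k\<close>
    unfolding n_def by linarith
  then have "real (d * k ^ n * c) \<le> real (L ^ n)"
    using False by (simp add: power_divide field_simps)
  then have "d * k ^ n * c \<le> L ^ n" by linarith
  then show ?thesis unfolding n_def by (intro exI[of _ "max n0 m"]) auto
qed

locale bijective_substitution =
  fixes \<theta> :: "'a::finite \<Rightarrow> 'a list" and L :: nat
  assumes two_le_L: "2 \<le> L"
    and const_len: "constant_length \<theta> L"
    and primitive: "primitive_subst \<theta>"
    and bijective: "bijective_subst \<theta> L"
    and aperiodic: "aperiodic_subst \<theta>"
begin

abbreviation X where "X \<equiv> subst_space \<theta>"

text \<open>The place is an integer because it arises as a remainder of a place in a bi-infinite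
  point; only \<open>0 \<le> r\<close> and \<open>r < L ^ n\<close> are meaningful.\<close>

definition col :: "nat \<Rightarrow> int \<Rightarrow> 'a \<Rightarrow> 'a" where
  "col n r a = subst_power \<theta> n a ! nat r"

text \<open>This is \<theta>^n on bi-infinite points, normalised so that the cuts are the multiples
  of L^n.\<close>

definition inflate :: "nat \<Rightarrow> (int \<Rightarrow> 'a) \<Rightarrow> int \<Rightarrow> 'a" where
  "inflate n y i = col n (i mod int L ^ n) (y (i div int L ^ n))"

lemma L_pos [simp]: "0 < L"
  using two_le_L by simp

lemma pow_pos: "0 < int L ^ n"
  by simp

lemma length_subst_power: "length (subst_power \<theta> n a) = L ^ n"
proof (induction n)
  case (Suc n)
  have "length (extend \<theta> w) = L * length w" for w
    using const_len by (induction w) (auto simp: extend_def constant_length_def)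
  then show ?case using Suc by (simp add: subst_power_def)
qed (simp add: subst_power_def)

lemma col_0 [simp]: "col 0 0 a = a"
  by (simp add: col_def subst_power_def)

lemma col_add:
  assumes "0 \<le> r" "r < int L ^ (n + k)"
  shows "col (n + k) r a = col n (r mod int L ^ n) (col k (r div int L ^ n) a)"
proof -
  have r: "nat r < L ^ n * L ^ k"
    using assms by (simp add: nat_less_iff power_add)
  have "subst_power \<theta> (n + k) a = concat (map (subst_power \<theta> n) (subst_power \<theta> k a))"
    using extend_funpow[of n \<theta> "subst_power \<theta> k a"] by (simp add: subst_power_def funpow_add)
  then have "subst_power \<theta> (n + k) a ! nat r =
      map (subst_power \<theta> n) (subst_power \<theta> k a) ! (nat r div L ^ n) ! (nat r mod L ^ n)"
    using r by (simp add: nth_concat_const length_subst_power)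
  moreover have "nat r div L ^ n < L ^ k"
    using r by (simp add: less_mult_imp_div_less mult.commute)
  ultimately show ?thesis
    using assms by (simp add: col_def length_subst_power nat_div_distrib nat_mod_distrib nat_power_eq)
qed

text \<open>A column of \<theta>^n is a composite of n columns of \<theta>, so bijectivity passes to
  powers.\<close>

lemma inj_col:
  assumes "0 \<le> r" "r < int L ^ n"
  shows "inj (col n r)"
  using assms
proof (induction n arbitrary: r)
  case 0
  then have "r = 0" by simp
  then show ?case by (simp add: inj_def)
next
  case (Suc n)
  have 1: "subst_power \<theta> 1 a = \<theta> a" for a by (simp add: subst_power_def extend_def)
  have "nat (r mod int L) < L" using two_le_L by (simp add: nat_less_iff)
  then have "inj (col 1 (r mod int L))"
    using bijective unfolding bijective_subst_def col_def 1 by (auto dest: bij_is_inj)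
  moreover have "inj (col n (r div int L))"
  proof (rule Suc.IH)
    show "0 \<le> r div int L" using Suc.prems two_le_L by (simp add: pos_imp_zdiv_nonneg_iff)
    show "r div int L < int L ^ n"
      using Suc.prems by (simp add: zdiv_less_iff mult.commute)
  qed
  moreover have "col (Suc n) r = col 1 (r mod int L) \<circ> col n (r div int L)"
    using col_add[of r 1 n] Suc.prems by (auto simp: fun_eq_iff)
  ultimately show ?case by (metis inj_compose)
qed

lemma col_eq_iff: "0 \<le> r \<Longrightarrow> r < int L ^ n \<Longrightarrow> col n r a = col n r b \<longleftrightarrow> a = b"
  using inj_col by (auto dest: injD)

text \<open>The offset \<open>c\<close> aligns the places of the window with those of \<theta>^k(a);
  occurrences of words thereby become integer arithmetic.\<close>

lemma allowed_window_iff: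
  "allowed \<theta> (map x [m..n]) \<longleftrightarrow>
    (\<exists>k a c. \<forall>i. m \<le> i \<and> i \<le> n \<longrightarrow> 0 \<le> i + c \<and> i + c < int L ^ k \<and> x i = col k (i + c) a)"
  (is "?l \<longleftrightarrow> ?r")
proof
  assume ?l
  then obtain k a u v where uv: "subst_power \<theta> k a = u @ map x [m..n] @ v"
    unfolding allowed_def sublist_def by auto
  let ?c = "int (length u) - m"
  have "0 \<le> i + ?c \<and> i + ?c < int L ^ k \<and> x i = col k (i + ?c) a" if "m \<le> i" "i \<le> n" for i
  proof -
    have "L ^ k = length u + (nat (n - m + 1) + length v)"
      using uv length_subst_power[of k a] by simp
    then have "int L ^ k = int (length u + (nat (n - m + 1) + length v))"
      by (metis of_nat_power)
    then have "i + ?c < int L ^ k" using that by simp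
    moreover have "nat (i + ?c) = length u + nat (i - m)" using that by simp
    then have "col k (i + ?c) a = x i"
      unfolding col_def uv using that by (simp add: nth_append)
    ultimately show ?thesis using that by simp
  qed
  then show ?r by blast
next
  assume ?r
  then obtain k a c where c: "\<And>i. m \<le> i \<Longrightarrow> i \<le> n \<Longrightarrow> 0 \<le> i + c \<and> i + c < int L ^ k \<and> x i = col k (i + c) a"
    by blast
  show ?l
  proof (cases "m \<le> n")
    case False
    then show ?thesis by (simp add: allowed_def)
  next
    case True
    let ?w = "subst_power \<theta> k a"
    have mc: "0 \<le> m + c" "n + c < int L ^ k" using c[of m] c[of n] True by auto
    have "n + c < int (L ^ k)" using mc by simp
    then have le: "nat (m + c) + nat (n - m + 1) \<le> L ^ k" using mc True by linarith
    have "map x [m..n] = take (nat (n - m + 1)) (drop (nat (m + c)) ?w)"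
    proof (rule nth_equalityI)
      show "length (map x [m..n]) = length (take (nat (n - m + 1)) (drop (nat (m + c)) ?w))"
        using le True by (simp add: length_subst_power)
      fix j assume j: "j < length (map x [m..n])"
      then have "nat (m + int j + c) = nat (m + c) + j" using mc by simp
      then show "map x [m..n] ! j = take (nat (n - m + 1)) (drop (nat (m + c)) ?w) ! j"
        using j c[of "m + int j"] le by (simp add: col_def length_subst_power)
    qed
    then have "sublist (map x [m..n]) ?w"
      by (metis sublist_take sublist_drop sublist_order.order_trans)
    then show ?thesis unfolding allowed_def by blast
  qed
qed

lemma in_X_iff:
  "x \<in> X \<longleftrightarrow> (\<forall>m n. \<exists>k a c. \<forall>i. m \<le> i \<and> i \<le> n \<longrightarrow>
     0 \<le> i + c \<and> i + c < int L ^ k \<and> x i = col k (i + c) a)"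
  unfolding subst_space_def mem_Collect_eq allowed_window_iff ..

lemma in_X_locally:
  assumes "\<And>m. \<exists>u\<in>X. \<forall>i. \<bar>i\<bar> \<le> m \<longrightarrow> x i = u i"
  shows "x \<in> X"
  unfolding subst_space_def mem_Collect_eq
proof (intro allI)
  fix m n
  obtain u where u: "u \<in> X" "\<forall>i. \<bar>i\<bar> \<le> max \<bar>m\<bar> \<bar>n\<bar> \<longrightarrow> x i = u i" using assms by blast
  then have eq: "map x [m..n] = map u [m..n]" by auto
  show "allowed \<theta> (map x [m..n])" unfolding eq using u(1) by (simp add: subst_space_def)
qed

lemma inflate_0 [simp]: "inflate 0 y = y"
  by (simp add: inflate_def fun_eq_iff)

lemma inflate_inflate: "inflate n (inflate k y) = inflate (n + k) y"
proof
  fix i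
  let ?r = "i mod int L ^ (n + k)"
  have "int L ^ (n + k) = int L ^ n * int L ^ k" by (simp add: power_add)
  then have "?r = int L ^ n * (i div int L ^ n mod int L ^ k) + i mod int L ^ n"
    "i div int L ^ (n + k) = i div int L ^ n div int L ^ k"
    by (simp_all add: zmod_zmult2_eq zdiv_zmult2_eq)
  moreover from this(1) have "?r mod int L ^ n = i mod int L ^ n"
    "?r div int L ^ n = (i div int L ^ n) mod int L ^ k"
    using div_mult_self4[of "int L ^ n" "i div int L ^ n mod int L ^ k" "i mod int L ^ n"] by auto
  moreover have "0 \<le> ?r" "?r < int L ^ (n + k)" by simp_all
  ultimately show "inflate n (inflate k y) i = inflate (n + k) y i"
    unfolding inflate_def by (simp only: col_add)
qed

lemma inflate_shift: "inflate n (shift j y) = shift (j * int L ^ n) (inflate n y)"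
  using pow_pos[of n] by (auto simp: inflate_def shift_def fun_eq_iff add.commute)

lemma inflate_block:
  assumes "0 \<le> r" "r < int L ^ n"
  shows "inflate n y (l * int L ^ n + r) = col n r (y l)"
proof -
  have "(l * int L ^ n + r) div int L ^ n = l" "(l * int L ^ n + r) mod int L ^ n = r"
    using assms by (auto simp: div_add1_eq)
  then show ?thesis by (simp add: inflate_def)
qed

text \<open>The main effect of bijectivity: comparing one place of a block already compares the
  letters that generate the whole block.\<close>

lemma inflate_eq_iff:
  "inflate n y i = inflate n y' i \<longleftrightarrow> y (i div int L ^ n) = y' (i div int L ^ n)"
  by (simp add: inflate_def col_eq_iff)

lemma inflate_inj: "inflate n y = inflate n y' \<Longrightarrow> y = y'"
proof
  fix l assume "inflate n y = inflate n y'"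
  then have "inflate n y (l * int L ^ n) = inflate n y' (l * int L ^ n)" by simp
  then show "y l = y' l" unfolding inflate_eq_iff by simp
qed

lemma inflate_in_X:
  assumes "y \<in> X"
  shows "inflate n y \<in> X"
  unfolding in_X_iff
proof (intro allI)
  fix m m' :: int
  let ?N = "int L ^ n"
  obtain k a c where c: "\<And>i. m div ?N \<le> i \<Longrightarrow> i \<le> m' div ?N \<Longrightarrow>
      0 \<le> i + c \<and> i + c < int L ^ k \<and> y i = col k (i + c) a"
    using assms[unfolded in_X_iff, rule_format, of "m div ?N" "m' div ?N"] by blast
  have "0 \<le> i + c * ?N \<and> i + c * ?N < int L ^ (n + k) \<and> inflate n y i = col (n + k) (i + c * ?N) a"
    if "m \<le> i" "i \<le> m'" for i
  proof -
    have d: "(i + c * ?N) div ?N = i div ?N + c" "(i + c * ?N) mod ?N = i mod ?N"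
      using pow_pos[of n] by auto
    have b: "0 \<le> i div ?N + c \<and> i div ?N + c < int L ^ k \<and> y (i div ?N) = col k (i div ?N + c) a"
      using that by (intro c zdiv_mono1 pow_pos)
    have "0 \<le> i + c * ?N"
      using b pos_imp_zdiv_nonneg_iff[OF pow_pos, of "i + c * ?N" n] unfolding d(1) by simp
    moreover have "i + c * ?N < int L ^ (n + k)"
      using b zdiv_less_iff[OF pow_pos, of "i + c * ?N" n "int L ^ k"] unfolding d(1)
      by (simp add: power_add mult.commute)
    ultimately show ?thesis using b d by (simp add: col_add inflate_def add.commute[of c])
  qed
  then show "\<exists>k a c. \<forall>i. m \<le> i \<and> i \<le> m' \<longrightarrow>
     0 \<le> i + c \<and> i + c < int L ^ k \<and> inflate n y i = col k (i + c) a"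
    by blast
qed

text \<open>By bijectivity a point is determined by one letter in each block of its inflation; this
  replaces the usual compactness argument.\<close>

lemma inflate_closed:
  assumes "\<And>m. \<exists>u\<in>X. \<forall>i. \<bar>i\<bar> \<le> m \<longrightarrow> z i = inflate n u i"
  shows "\<exists>u\<in>X. z = inflate n u"
proof -
  let ?N = "int L ^ n"
  obtain v where v: "\<And>m. v m \<in> X" "\<And>m i. \<bar>i\<bar> \<le> m \<Longrightarrow> z i = inflate n (v m) i"
    using assms by metis
  define u where "u l = v \<bar>l * ?N\<bar> l" for l
  have u: "u l = v m l" if "\<bar>l * ?N\<bar> \<le> m" for l m
  proof -
    have "inflate n (v \<bar>l * ?N\<bar>) (l * ?N + 0) = inflate n (v m) (l * ?N + 0)"
      using v(2)[of "l * ?N" m] v(2)[of "l * ?N" "\<bar>l * ?N\<bar>"] that by simp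
    then show ?thesis unfolding u_def inflate_eq_iff by simp
  qed
  have "u \<in> X"
  proof (rule in_X_locally)
    fix m :: int
    have "\<forall>i. \<bar>i\<bar> \<le> m \<longrightarrow> u i = v (m * ?N) i"
      by (auto intro!: u simp: abs_mult)
    then show "\<exists>w\<in>X. \<forall>i. \<bar>i\<bar> \<le> m \<longrightarrow> u i = w i" using v(1) by blast
  qed
  moreover have "z i = inflate n u i" for i
  proof -
    let ?m = "max \<bar>i\<bar> \<bar>i div ?N * ?N\<bar>"
    have "z i = inflate n (v ?m) i" by (intro v(2)) simp
    moreover have "u (i div ?N) = v ?m (i div ?N)" by (intro u) simp
    ultimately show ?thesis by (simp add: inflate_def)
  qed
  ultimately show ?thesis by blast
qed

text \<open>The window of \<open>x\<close> on [-m, m] sits in some \<theta>^k(a) at an offset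
  \<open>c m\<close>, and only the residue of the offset mod L^n decides where blocks are cut. There
  are finitely many residues, so one of them occurs for arbitrarily large windows, and its cuts are
  consistent on all of Z.\<close>

lemma desubstitute:
  assumes x: "x \<in> X"
  shows "\<exists>i y. 0 \<le> i \<and> i < int L ^ n \<and> y \<in> X \<and> x = shift i (inflate n y)"
proof -
  let ?N = "int L ^ n"
  have "\<exists>c k a. \<forall>i. \<bar>i\<bar> \<le> int m \<longrightarrow> 0 \<le> i + c \<and> i + c < int L ^ k \<and> x i = col k (i + c) a" for m
  proof -
    obtain k a c where *: "\<forall>i. - int m \<le> i \<and> i \<le> int m \<longrightarrow>
        0 \<le> i + c \<and> i + c < int L ^ k \<and> x i = col k (i + c) a"
      using x[unfolded in_X_iff, rule_format, of "- int m" "int m"] by (elim exE)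
    show ?thesis
      by (rule exI[of _ c], rule exI[of _ k], rule exI[of _ a], intro allI impI, rule *[rule_format]) linarith
  qed
  then have "\<exists>c. \<forall>m. \<exists>k a. \<forall>i. \<bar>i\<bar> \<le> int m \<longrightarrow>
      0 \<le> i + c m \<and> i + c m < int L ^ k \<and> x i = col k (i + c m) a"
    by (intro choice allI)
  then obtain c where c: "\<And>m. \<exists>k a. \<forall>i. \<bar>i\<bar> \<le> int m \<longrightarrow> 0 \<le> i + c m \<and> i + c m < int L ^ k \<and> x i = col k (i + c m) a"
    by (elim exE) blast
  have "finite ((\<lambda>m. c m mod ?N) ` UNIV)"
    by (rule finite_subset[of _ "{0..<?N}"]) (auto simp: pow_pos)
  then obtain m0 where m0: "infinite {m. c m mod ?N = c m0 mod ?N}"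
    using pigeonhole_infinite[of UNIV "\<lambda>m. c m mod ?N"] by auto
  define j where "j = c m0 mod ?N"
  have block: "\<exists>k a c. \<forall>l. \<bar>l * ?N\<bar> \<le> m \<longrightarrow> 0 \<le> l + c \<and> l + c < int L ^ k \<and>
        (\<forall>r. 0 \<le> r \<and> r < ?N \<longrightarrow> x (l * ?N + r - j) = col n r (col k (l + c) a))" for m
  proof -
    \<comment> \<open>The margin keeps the complete blocks in question, moved by \<open>- j\<close>,
      inside the window; it also makes \<theta>^k(a) longer than L^n, so that n \<le> k and the word
      splits into blocks of \<theta>^n.\<close>
    define m1 where "m1 = \<bar>m\<bar> + 2 * ?N"
    have "infinite {m. c m mod ?N = j}" using m0 by (simp add: j_def)
    then obtain m2 where m2: "c m2 mod ?N = j" "nat m1 \<le> m2"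
      unfolding infinite_nat_iff_unbounded_le by blast
    then have m1: "m1 \<le> int m2" by linarith
    obtain k a where "\<forall>i. \<bar>i\<bar> \<le> int m2 \<longrightarrow>
        0 \<le> i + c m2 \<and> i + c m2 < int L ^ k \<and> x i = col k (i + c m2) a"
      using c[of m2] by (elim exE)
    note ka = this[rule_format]
    have "?N < int L ^ k"
      using ka[of "- int m2"] ka[of "int m2"] m1 pow_pos[of n] unfolding m1_def by linarith
    then have "n \<le> k"
      using power_increasing[of k n "int L"] two_le_L by linarith
    then obtain k' where k': "k = n + k'" using le_Suc_ex by blast
    define c' where "c' = c m2 div ?N"
    have c': "c m2 = c' * ?N + j" unfolding c'_def using div_mult_mod_eq[of "c m2" ?N] m2(1) by simp
    have jN: "0 \<le> j" "j < ?N" unfolding j_def by simp_all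
    have "0 \<le> l + c' \<and> l + c' < int L ^ k' \<and>
        (\<forall>r. 0 \<le> r \<and> r < ?N \<longrightarrow> x (l * ?N + r - j) = col n r (col k' (l + c') a))"
      if l: "\<bar>l * ?N\<bar> \<le> m" for l
    proof -
      have in_range: "\<bar>l * ?N + r - j\<bar> \<le> int m2" if "0 \<le> r" "r < ?N" for r
        using l that jN m1 unfolding m1_def by linarith
      have eq: "l * ?N + r - j + c m2 = (l + c') * ?N + r" for r
        unfolding c' by (simp add: algebra_simps)
      have ran: "0 \<le> (l + c') * ?N" "(l + c') * ?N < int L ^ (n + k')"
        using ka[OF in_range[of 0]] eq[of 0] unfolding k' by simp_all
      have "0 \<le> l + c'"
        using ran(1) pow_pos[of n] zero_le_mult_iff[of "l + c'" ?N] by linarith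
      moreover have "l + c' < int L ^ k'"
        using ran(2) by (simp add: power_add mult.commute)
      moreover have "x (l * ?N + r - j) = col n r (col k' (l + c') a)" if r: "0 \<le> r" "r < ?N" for r
      proof -
        have "((l + c') * ?N + r) mod ?N = r" "((l + c') * ?N + r) div ?N = l + c'"
          using r by (auto simp: div_add1_eq)
        moreover have "0 \<le> (l + c') * ?N + r \<and> (l + c') * ?N + r < int L ^ k
            \<and> x (l * ?N + r - j) = col k ((l + c') * ?N + r) a"
          using ka[OF in_range[OF r]] unfolding eq .
        ultimately show ?thesis unfolding k' by (simp add: col_add)
      qed
      ultimately show ?thesis by blast
    qed
    then show ?thesis by blast
  qed
  \<comment> \<open>Column 0 is injective, so the generating letter can be read off at the
    cut.\<close>
  define y where "y l = the_inv (col n 0) (x (l * ?N - j))" for l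
  have inj0: "inj (col n 0)" by (rule inj_col) simp_all
  have y: "y l = b" if "x (l * ?N + 0 - j) = col n 0 b" for l b
    using that by (simp add: y_def the_inv_f_f[OF inj0])
  have "y \<in> X"
    unfolding in_X_iff
  proof (intro allI)
    fix p q :: int
    obtain k a c where *: "\<forall>l. \<bar>l * ?N\<bar> \<le> (\<bar>p\<bar> + \<bar>q\<bar>) * ?N \<longrightarrow> 0 \<le> l + c \<and> l + c < int L ^ k \<and>
        (\<forall>r. 0 \<le> r \<and> r < ?N \<longrightarrow> x (l * ?N + r - j) = col n r (col k (l + c) a))"
      using block by blast
    have "0 \<le> i + c \<and> i + c < int L ^ k \<and> y i = col k (i + c) a" if "p \<le> i" "i \<le> q" for i
    proof -
      have "\<bar>i * ?N\<bar> \<le> (\<bar>p\<bar> + \<bar>q\<bar>) * ?N" using that unfolding abs_mult by (intro mult_mono) auto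
      note b = *[rule_format, OF this]
      have "y i = col k (i + c) a" using b pow_pos[of n] by (intro y) blast
      then show ?thesis using b by blast
    qed
    then show "\<exists>k a c. \<forall>i. p \<le> i \<and> i \<le> q \<longrightarrow> 0 \<le> i + c \<and> i + c < int L ^ k \<and> y i = col k (i + c) a"
      by blast
  qed
  moreover have "x i = shift j (inflate n y) i" for i
  proof -
    let ?l = "(i + j) div ?N" and ?r = "(i + j) mod ?N"
    obtain b where b: "\<forall>r. 0 \<le> r \<and> r < ?N \<longrightarrow> x (?l * ?N + r - j) = col n r b"
      using block[of "\<bar>?l * ?N\<bar>"] by blast
    have i: "?l * ?N + ?r - j = i" unfolding div_mult_mod_eq by simp
    have "y ?l = b" using b pow_pos[of n] by (intro y) blast
    moreover have "x i = col n ?r b" using b[rule_format, of ?r] unfolding i by simp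
    ultimately show ?thesis by (simp add: shift_def inflate_def)
  qed
  moreover have "0 \<le> j" "j < ?N" by (simp_all add: j_def)
  ultimately show ?thesis by (intro exI[of _ j] exI[of _ y]) auto
qed

section \<open>Linear recurrence\<close>

lemma ex_primitive_power: "\<exists>K. \<forall>a b. \<exists>r. 0 \<le> r \<and> r < int L ^ K \<and> col K r b = a"
proof -
  obtain K where K: "\<And>a b. a \<in> set (subst_power \<theta> K b)"
    using primitive unfolding primitive_subst_def by blast
  have "\<exists>r. 0 \<le> r \<and> r < int L ^ K \<and> col K r b = a" for a b
  proof -
    obtain j where j: "j < L ^ K" "subst_power \<theta> K b ! j = a"
      using K[of a b] by (auto simp: in_set_conv_nth length_subst_power)
    then have "int j < int (L ^ K)" by linarith
    then have "0 \<le> int j \<and> int j < int L ^ K \<and> col K (int j) b = a" using j by (simp add: col_def)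
    then show ?thesis by blast
  qed
  then show ?thesis by blast
qed

text \<open>The word of \<open>z\<close> lies in \<theta>^k(a), and by primitivity a lies in
  \<theta>^K(b) for every b. So the word occurs in every block of \<theta>^(k+K), and a window of
  twice the block length contains a complete block.\<close>

lemma recurrent:
  assumes "z \<in> X"
  shows "\<exists>R\<ge>0. \<forall>x\<in>X. \<forall>t. \<exists>j. t \<le> j + p \<and> j + q \<le> t + R \<and> (\<forall>i. p \<le> i \<and> i \<le> q \<longrightarrow> x (i + j) = z i)"
proof (cases "p \<le> q")
  case True
  obtain k a c where c: "\<forall>i. p \<le> i \<and> i \<le> q \<longrightarrow> 0 \<le> i + c \<and> i + c < int L ^ k \<and> z i = col k (i + c) a"
    using assms[unfolded in_X_iff, rule_format, of p q] by (elim exE)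
  obtain K where K: "\<And>a b. \<exists>r. 0 \<le> r \<and> r < int L ^ K \<and> col K r b = a"
    using ex_primitive_power by blast
  let ?N = "int L ^ (k + K)"
  have "\<exists>j. t \<le> j + p \<and> j + q \<le> t + 2 * ?N \<and> (\<forall>i. p \<le> i \<and> i \<le> q \<longrightarrow> x (i + j) = z i)"
    if x: "x \<in> X" for x t
  proof -
    obtain s y where y: "y \<in> X" "x = shift s (inflate (k + K) y)"
      using desubstitute[OF x, of "k + K"] by blast
    \<comment> \<open>The first block that starts after place \<open>t\<close>.\<close>
    define l where "l = (t + s) div ?N + 1"
    have tl: "t + s \<le> l * ?N" "l * ?N \<le> t + s + ?N"
    proof -
      have "t + s = (t + s) div ?N * ?N + (t + s) mod ?N" by (rule div_mult_mod_eq[symmetric])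
      moreover have "0 \<le> (t + s) mod ?N" "(t + s) mod ?N < ?N" using pow_pos by simp_all
      ultimately show "t + s \<le> l * ?N" "l * ?N \<le> t + s + ?N"
        unfolding l_def distrib_right by linarith+
    qed
    obtain r where r: "0 \<le> r" "r < int L ^ K" "col K r (y l) = a" using K by blast
    have rN: "0 \<le> r * int L ^ k" "r * int L ^ k \<le> (int L ^ K - 1) * int L ^ k"
      using r by (auto intro!: mult_right_mono)
    have N: "(int L ^ K - 1) * int L ^ k + int L ^ k = ?N" by (simp add: power_add algebra_simps)
    define j where "j = l * ?N - s + r * int L ^ k + c"
    have "x (i + j) = z i" if i: "p \<le> i" "i \<le> q" for i
    proof -
      have ic: "0 \<le> i + c" "i + c < int L ^ k" "z i = col k (i + c) a" using c i by blast+
      let ?r = "r * int L ^ k + (i + c)"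
      have r': "0 \<le> ?r" "?r < ?N" using rN N ic by linarith+
      have "x (i + j) = inflate (k + K) y (l * ?N + ?r)"
        unfolding y(2) j_def shift_def by (simp add: algebra_simps)
      also have "\<dots> = col (k + K) ?r (y l)" using r' by (rule inflate_block)
      also have "\<dots> = col k (?r mod int L ^ k) (col K (?r div int L ^ k) (y l))"
        using r' by (rule col_add)
      also have "?r mod int L ^ k = i + c" using ic by simp
      also have "?r div int L ^ k = r" using ic by simp
      also have "col k (i + c) (col K r (y l)) = z i" using ic(3) r(3) by simp
      finally show ?thesis .
    qed
    moreover have "t \<le> j + p" "j + q \<le> t + 2 * ?N"
      using c[rule_format, of p] c[rule_format, of q] True rN N tl unfolding j_def by linarith+
    ultimately show ?thesis by blast
  qed
  then show ?thesis by (intro exI[of _ "2 * ?N"]) auto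
next
  case False
  then show ?thesis by (intro exI[of _ 0]) (auto intro: exI[of _ "_ - p"])
qed

text \<open>The bound must not depend on the word, which works because there are finitely many pairs
  of letters. Pairs are the right unit since L^n + 1 consecutive places meet at most two blocks of
  length L^n.\<close>

lemma recurrent_pairs:
  "\<exists>R\<ge>0. \<forall>x\<in>X. \<forall>z\<in>X. \<forall>t l. \<exists>j\<ge>t. j \<le> t + R \<and> x j = z l \<and> x (j + 1) = z (l + 1)"
proof -
  have "\<exists>R\<ge>0. (\<exists>z\<in>X. \<exists>l. z l = a \<and> z (l + 1) = b) \<longrightarrow>
      (\<forall>x\<in>X. \<forall>t. \<exists>j\<ge>t. j \<le> t + R \<and> x j = a \<and> x (j + 1) = b)" for a b
  proof (cases "\<exists>z\<in>X. \<exists>l. z l = a \<and> z (l + 1) = b")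
    case True
    then obtain z l where z: "z \<in> X" "z l = a" "z (l + 1) = b" by blast
    obtain R where R: "R \<ge> 0" "\<And>x t. x \<in> X \<Longrightarrow> \<exists>j. t \<le> j + l \<and> j + (l + 1) \<le> t + R \<and>
        (\<forall>i. l \<le> i \<and> i \<le> l + 1 \<longrightarrow> x (i + j) = z i)"
      using recurrent[OF z(1), of l "l + 1"] by blast
    have "\<exists>j\<ge>t. j \<le> t + R \<and> x j = a \<and> x (j + 1) = b" if x: "x \<in> X" for x t
    proof -
      obtain j where j: "t \<le> j + l" "j + (l + 1) \<le> t + R" "\<forall>i. l \<le> i \<and> i \<le> l + 1 \<longrightarrow> x (i + j) = z i"
        using R(2)[OF x, of t] by blast
      have "x (j + l) = a" "x (j + l + 1) = b"
        using j(3)[rule_format, of l] j(3)[rule_format, of "l + 1"] z by (simp_all add: algebra_simps)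
      then show ?thesis using j by (intro exI[of _ "j + l"]) auto
    qed
    then show ?thesis using R(1) by blast
  qed auto
  then obtain R where R: "\<And>a b. R a b \<ge> (0::int)" "\<And>a b z l x t. z \<in> X \<Longrightarrow> z l = a \<Longrightarrow> z (l + 1) = b \<Longrightarrow> x \<in> X \<Longrightarrow>
      \<exists>j\<ge>t. j \<le> t + R a b \<and> x j = a \<and> x (j + 1) = b"
    by metis
  let ?R = "\<Sum>(a, b)\<in>UNIV. R a b"
  have le: "R a b \<le> ?R" for a b
    using member_le_sum[of "(a, b)" UNIV "\<lambda>(a, b). R a b"] R(1) by auto
  have "\<exists>j\<ge>t. j \<le> t + ?R \<and> x j = z l \<and> x (j + 1) = z (l + 1)" if "x \<in> X" "z \<in> X" for x z t l
    using R(2)[OF that(2) refl refl that(1), of t l] le[of "z l" "z (l + 1)"] by force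
  moreover have "0 \<le> ?R" using le R(1) order_trans by blast
  ultimately show ?thesis by blast
qed

text \<open>The window of \<open>z\<close> lies in the blocks of two consecutive letters of its
  desubstitution. This pair recurs with bounded gaps in the desubstitution of \<open>x\<close>, and
  inflating multiplies the gaps by L^n.\<close>

lemma linearly_recurrent:
  "\<exists>C. \<forall>n. \<forall>x\<in>X. \<forall>z\<in>X. \<forall>t p. \<exists>j\<ge>t. j + int L ^ n \<le> t + int C * int L ^ n \<and>
     (\<forall>r. 0 \<le> r \<and> r \<le> int L ^ n \<longrightarrow> x (j + r) = z (p + r))"
proof -
  obtain R where R: "R \<ge> 0" "\<And>x z t l. x \<in> X \<Longrightarrow> z \<in> X \<Longrightarrow>
      \<exists>j\<ge>t. j \<le> t + R \<and> x j = z l \<and> x (j + 1) = z (l + 1)"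
    using recurrent_pairs by blast
  have "\<exists>j\<ge>t. j + int L ^ n \<le> t + int (nat (R + 3)) * int L ^ n \<and>
     (\<forall>r. 0 \<le> r \<and> r \<le> int L ^ n \<longrightarrow> x (j + r) = z (p + r))" if X: "x \<in> X" "z \<in> X" for n x z t p
  proof -
    let ?N = "int L ^ n"
    obtain s y where y: "0 \<le> s" "s < ?N" "y \<in> X" "x = shift s (inflate n y)"
      using desubstitute[OF X(1), of n] by blast
    obtain s' u where u: "u \<in> X" "z = shift s' (inflate n u)"
      using desubstitute[OF X(2), of n] by blast
    define l where "l = (p + s') div ?N"
    define e where "e = (p + s') mod ?N"
    have le: "p + s' = l * ?N + e" "0 \<le> e" "e < ?N"
      unfolding l_def e_def by (rule div_mult_mod_eq[symmetric], simp_all)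
    define l0 where "l0 = (t + s) div ?N + 1"
    have l0: "t + s \<le> l0 * ?N" "l0 * ?N \<le> t + s + ?N"
    proof -
      have "t + s = (t + s) div ?N * ?N + (t + s) mod ?N" by (rule div_mult_mod_eq[symmetric])
      moreover have "0 \<le> (t + s) mod ?N" "(t + s) mod ?N < ?N" using pow_pos by simp_all
      ultimately show "t + s \<le> l0 * ?N" "l0 * ?N \<le> t + s + ?N"
        unfolding l0_def distrib_right by linarith+
    qed
    obtain l' where l': "l0 \<le> l'" "l' \<le> l0 + R" "y l' = u l" "y (l' + 1) = u (l + 1)"
      using R(2)[OF y(3) u(1)] by blast
    have "l0 * ?N \<le> l' * ?N" "l' * ?N \<le> (l0 + R) * ?N"
      using l' by (auto intro!: mult_right_mono)
    then have l'N: "l0 * ?N \<le> l' * ?N" "l' * ?N \<le> l0 * ?N + R * ?N" by (simp_all add: distrib_right)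
    define j where "j = l' * ?N + e - s"
    have "x (j + r) = z (p + r)" if r: "0 \<le> r" "r \<le> ?N" for r
    proof -
      have "inflate n y (l' * ?N + (e + r)) = inflate n u (l * ?N + (e + r))"
      proof (cases "e + r < ?N")
        case True
        then show ?thesis using l' le r by (simp only: inflate_block add_nonneg_nonneg)
      next
        case False
        let ?r = "e + r - ?N"
        have "l * ?N + (e + r) = (l + 1) * ?N + ?r" "l' * ?N + (e + r) = (l' + 1) * ?N + ?r"
          by (simp_all add: algebra_simps)
        moreover have "0 \<le> ?r" "?r < ?N" using False le r by linarith+
        ultimately show ?thesis using l' by (simp only: inflate_block)
      qed
      moreover have "x (j + r) = inflate n y (l' * ?N + (e + r))"
        unfolding y(4) j_def shift_def by (simp add: algebra_simps)
      moreover have "z (p + r) = inflate n u (l * ?N + (e + r))"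
      proof -
        have "p + r + s' = l * ?N + (e + r)" using le(1) by linarith
        then show ?thesis by (simp only: u(2) shift_def)
      qed
      ultimately show ?thesis by simp
    qed
    moreover have "t \<le> j" using l0 l'N le unfolding j_def by linarith
    \<comment> \<open>Beyond the gap \<open>R\<close>, one block pays for rounding up to the cut
      \<open>l0\<close>, one for the offset \<open>e\<close>, and one for the window itself.\<close>
    moreover have "j + ?N \<le> t + int (nat (R + 3)) * ?N"
    proof -
      have "int (nat (R + 3)) * ?N = R * ?N + 3 * ?N" using R(1) by (simp add: distrib_right)
      then show ?thesis using l0 l'N le y unfolding j_def by linarith
    qed
    ultimately show ?thesis by blast
  qed
  then show ?thesis by blast
qed

text \<open>For every p, the word of \<open>x\<close> starting at p has a copy inside the periodic
  stretch. As q \<le> L^n, the copy shows both p and p + q, so q is a period of all of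
  \<open>x\<close>, against aperiodicity. The inclusive bound on \<open>r\<close> covers q =
  L^n.\<close>

lemma no_long_period:
  assumes C: "\<forall>n. \<forall>x\<in>X. \<forall>z\<in>X. \<forall>t p. \<exists>j\<ge>t. j + int L ^ n \<le> t + int C * int L ^ n \<and>
     (\<forall>r. 0 \<le> r \<and> r \<le> int L ^ n \<longrightarrow> x (j + r) = z (p + r))"
    and "x \<in> X" "0 < q" "q \<le> int L ^ n"
    and per: "\<And>i. t \<le> i \<Longrightarrow> i \<le> t + int C * int L ^ n \<Longrightarrow> x (i + q) = x i"
  shows False
proof -
  have "shift q x = x"
  proof
    fix p
    obtain j where j: "j \<ge> t" "j + int L ^ n \<le> t + int C * int L ^ n"
      "\<forall>r. 0 \<le> r \<and> r \<le> int L ^ n \<longrightarrow> x (j + r) = x (p + r)"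
      using C \<open>x \<in> X\<close> by blast
    have "x (p + q) = x (j + q)" "x p = x j"
      using j(3)[rule_format, of q] j(3)[rule_format, of 0] assms(3,4) by simp_all
    moreover have "x (j + q) = x j" using j by (intro per) (simp_all add: order_trans[OF _ j(2)])
    ultimately show "shift q x p = x p" by (simp add: shift_def)
  qed
  then show False using aperiodic assms(2,3) unfolding aperiodic_subst_def by blast
qed

section \<open>Recognizability\<close>

text \<open>Recognizability says that this forces L^n to divide k. Quantifying over all points of X
  makes the property additive in k.\<close>

definition shift_invariant :: "nat \<Rightarrow> int \<Rightarrow> bool" where
  "shift_invariant n k \<longleftrightarrow> (\<forall>y\<in>X. \<exists>u\<in>X. shift k (inflate n y) = inflate n u)"

text \<open>Any window of \<open>z\<close> recurs in \<open>y\<close> within a long stretch of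
  agreement, where the shifted inflation of \<open>y\<close> can be replaced by the inflation of
  \<open>y'\<close>. So the shifted inflation of \<open>z\<close> is a limit of points of
  \<theta>^n(X), which is closed.\<close>

lemma shift_invariant_if_agree:
  assumes "\<And>m. \<exists>y\<in>X. \<exists>y'\<in>X. \<exists>t. \<forall>i. t \<le> i \<and> i \<le> t + m \<longrightarrow> inflate n y (i + k) = inflate n y' i"
  shows "shift_invariant n k"
  unfolding shift_invariant_def
proof
  fix z assume z: "z \<in> X"
  let ?N = "int L ^ n"
  show "\<exists>u\<in>X. shift k (inflate n z) = inflate n u"
  proof (rule inflate_closed)
    fix M :: int
    define p where "p = (- \<bar>M\<bar> + k) div ?N"
    define q where "q = (\<bar>M\<bar> + k) div ?N"
    have pq: "p \<le> q" unfolding p_def q_def by (intro zdiv_mono1 pow_pos) simp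
    obtain R where R: "0 \<le> R" "\<forall>x\<in>X. \<forall>t. \<exists>j. t \<le> j + p \<and> j + q \<le> t + R \<and>
        (\<forall>i. p \<le> i \<and> i \<le> q \<longrightarrow> x (i + j) = z i)"
      using recurrent[OF z] by blast
    \<comment> \<open>Room for the places \<open>- M\<close> to \<open>M\<close>, for rounding up to
      a cut (one block), and for the recurrence gap (\<open>R\<close> blocks).\<close>
    define m where "m = 2 * \<bar>M\<bar> + (R + 1) * ?N"
    obtain y y' t where y: "y \<in> X" "y' \<in> X"
      "\<forall>i. t \<le> i \<and> i \<le> t + m \<longrightarrow> inflate n y (i + k) = inflate n y' i"
      using assms[of m] by blast
    define l where "l = (t + \<bar>M\<bar>) div ?N + 1"
    have l: "t + \<bar>M\<bar> \<le> l * ?N" "l * ?N \<le> t + \<bar>M\<bar> + ?N"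
    proof -
      have "t + \<bar>M\<bar> = (t + \<bar>M\<bar>) div ?N * ?N + (t + \<bar>M\<bar>) mod ?N" by (rule div_mult_mod_eq[symmetric])
      moreover have "0 \<le> (t + \<bar>M\<bar>) mod ?N" "(t + \<bar>M\<bar>) mod ?N < ?N" using pow_pos by simp_all
      ultimately show "t + \<bar>M\<bar> \<le> l * ?N" "l * ?N \<le> t + \<bar>M\<bar> + ?N"
        unfolding l_def distrib_right by linarith+
    qed
    obtain j where j: "l + p \<le> j + p" "j + q \<le> l + p + R" "\<forall>i. p \<le> i \<and> i \<le> q \<longrightarrow> y (i + j) = z i"
      using R(2)[rule_format, OF y(1), of "l + p"] by blast
    have "l * ?N \<le> j * ?N" "j * ?N \<le> (l + R) * ?N"
      using j pq by (auto intro!: mult_right_mono)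
    then have jN: "l * ?N \<le> j * ?N" "j * ?N \<le> l * ?N + R * ?N" by (simp_all add: distrib_right)
    have "shift k (inflate n z) i = inflate n (shift j y') i" if i: "\<bar>i\<bar> \<le> M" for i
    proof -
      have b: "p \<le> (i + k) div ?N" "(i + k) div ?N \<le> q"
        unfolding p_def q_def using i by (auto intro!: zdiv_mono1 pow_pos)
      have "inflate n z (i + k) = inflate n (shift j y) (i + k)"
        unfolding inflate_eq_iff shift_def using j(3) b by simp
      also have "\<dots> = inflate n y (i + j * ?N + k)"
        unfolding inflate_shift unfolding shift_def by (simp add: algebra_simps)
      also have "\<dots> = inflate n y' (i + j * ?N)"
      proof (rule y(3)[rule_format], intro conjI)
        show "t \<le> i + j * ?N" using l jN i by linarith
        show "i + j * ?N \<le> t + m" unfolding m_def distrib_right using l jN i by linarith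
      qed
      finally show ?thesis unfolding inflate_shift unfolding shift_def .
    qed
    then show "\<exists>u\<in>X. \<forall>i. \<bar>i\<bar> \<le> M \<longrightarrow> shift k (inflate n z) i = inflate n u i"
      using shift_in_subst_space[OF y(2)] by blast
  qed
qed

lemma shift_invariant_if_eq:
  assumes "y \<in> X" "y' \<in> X" "shift k (inflate n y) = inflate n y'"
  shows "shift_invariant n k"
proof (rule shift_invariant_if_agree)
  fix m
  have "inflate n y (i + k) = inflate n y' i" for i
    using fun_cong[OF assms(3), of i] by (simp only: shift_def)
  then show "\<exists>y\<in>X. \<exists>y'\<in>X. \<exists>t. \<forall>i. t \<le> i \<and> i \<le> t + m \<longrightarrow> inflate n y (i + k) = inflate n y' i"
    using assms by blast
qed

lemma shift_invariant_add:
  "shift_invariant n j \<Longrightarrow> shift_invariant n k \<Longrightarrow> shift_invariant n (j + k)"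
  unfolding shift_invariant_def by (metis shift_shift)

lemma shift_invariant_mult: "shift_invariant n k \<Longrightarrow> shift_invariant n (int j * k)"
proof (induction j)
  case 0
  then show ?case by (auto simp: shift_invariant_def shift_0)
next
  case (Suc j)
  then have "shift_invariant n (k + int j * k)" by (intro shift_invariant_add) auto
  then show ?case by (simp add: distrib_right)
qed

text \<open>The shift of \<open>\<theta>\<^sup>n\<^sup>+\<^sup>1(X)\<close> by \<open>p\<close> lies in \<open>\<theta>\<^sup>n(X)\<close>, which is covered by the shifts of \<open>\<theta>\<^sup>n\<^sup>+\<^sup>1(X)\<close> by
  multiples \<open>i L\<^sup>n\<close>; so it equals one of these, and \<open>k\<close>-fold repetition removes \<open>i L\<^sup>n\<close>.\<close>

lemma shift_invariant_step:
  assumes p: "shift_invariant n p" and k: "shift_invariant 1 (int k)"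
  shows "shift_invariant (Suc n) (int k * p)"
proof (cases "X = {}")
  case True
  then show ?thesis by (simp add: shift_invariant_def)
next
  case False
  then obtain y where y: "y \<in> X" by blast
  let ?N = "int L ^ n"
  have inf: "inflate n (inflate 1 z) = inflate (Suc n) z" for z
    by (simp only: inflate_inflate Suc_eq_plus1)
  obtain u where u: "u \<in> X" "shift p (inflate n (inflate 1 y)) = inflate n u"
    using p inflate_in_X[OF y] unfolding shift_invariant_def by blast
  obtain i v where v: "0 \<le> i" "v \<in> X" "u = shift i (inflate 1 v)"
    using desubstitute[OF u(1), of 1] by blast
  have "shift p (inflate (Suc n) y) = shift (i * ?N) (inflate (Suc n) v)"
    using u(2) unfolding v(3) inflate_shift inf .
  then have "shift (- (i * ?N)) (shift p (inflate (Suc n) y)) = inflate (Suc n) v"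
    by (simp add: shift_shift shift_0)
  then have "shift_invariant (Suc n) (- (i * ?N) + p)"
    unfolding shift_shift using y v(2) shift_invariant_if_eq by blast
  then have "shift_invariant (Suc n) (int k * (- (i * ?N) + p))" by (rule shift_invariant_mult)
  \<comment> \<open>Applying \<theta>^n to the invariance of \<theta>(X) under the shift by k turns
    k into k L^n.\<close>
  moreover have "shift_invariant (Suc n) (int (nat i) * (int k * ?N))"
  proof (rule shift_invariant_mult)
    obtain w where w: "w \<in> X" "shift (int k) (inflate 1 y) = inflate 1 w"
      using k y unfolding shift_invariant_def by blast
    have "shift (int k * ?N) (inflate (Suc n) y) = inflate (Suc n) w"
      using arg_cong[OF w(2), of "inflate n"] unfolding inflate_shift inf .
    then show "shift_invariant (Suc n) (int k * ?N)" using y w(1) shift_invariant_if_eq by blast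
  qed
  ultimately have "shift_invariant (Suc n) (int k * (- (i * ?N) + p) + int (nat i) * (int k * ?N))"
    by (rule shift_invariant_add)
  moreover have "int k * (- (i * ?N) + p) + int (nat i) * (int k * ?N) = int k * p"
    using v(1) by (simp add: algebra_simps)
  ultimately show ?thesis by simp
qed

lemma shift_invariant_pow:
  "shift_invariant 1 (int k) \<Longrightarrow> shift_invariant n (int k ^ n)"
proof (induction n)
  case 0
  then show ?case by (auto simp: shift_invariant_def intro: shift_in_subst_space)
next
  case (Suc n)
  then show ?case using shift_invariant_step[of n "int k ^ n" k] by simp
qed

text \<open>Otherwise the sets \<open>\<theta>\<^sup>n(X)\<close> would be invariant under the shift by \<open>k\<^sup>n\<close>, which is negligible
  compared with the block length \<open>L\<^sup>n\<close>; the pigeonhole principle then yields a period that is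
  short compared with the window it extends over.\<close>

lemma not_shift_invariant:
  assumes "X \<noteq> {}" "0 < k" "k < L"
  shows "\<not> shift_invariant 1 (int k)"
proof
  assume inv: "shift_invariant 1 (int k)"
  obtain C where C: "\<forall>n. \<forall>x\<in>X. \<forall>z\<in>X. \<forall>t p. \<exists>j\<ge>t. j + int L ^ n \<le> t + int C * int L ^ n \<and>
     (\<forall>r. 0 \<le> r \<and> r \<le> int L ^ n \<longrightarrow> x (j + r) = z (p + r))"
    using linearly_recurrent by blast
  let ?d = "card (UNIV :: 'a set)"
  \<comment> \<open>Two levels are used: a block has length L^n, and the recurrence is applied at
    level n' = n - C. Then the stretch C L^n' fits into one block, while the expected period, at
    most \<open>?d * k ^ n\<close>, is still at most L^n'.\<close>
  obtain n where n: "C \<le> n" "?d * k ^ n * L ^ C \<le> L ^ n"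
    using eventually_power_dominates[OF assms(3)] by blast
  obtain n' where n': "n = n' + C" using n(1) le_Suc_ex add.commute by metis
  have "?d * k ^ n \<le> L ^ n'" using n(2) unfolding n' by (simp add: power_add)
  then have q: "int ?d * int k ^ n \<le> int L ^ n'"
    by (metis of_nat_le_iff of_nat_mult of_nat_power)
  have "C < L ^ C" using two_le_L by (simp add: power_gt_expt)
  then have "C * L ^ n' < L ^ n" unfolding n' by (simp add: power_add mult.commute)
  then have CN: "int C * int L ^ n' < int L ^ n"
    by (metis of_nat_less_iff of_nat_mult of_nat_power)
  obtain y where y: "y \<in> X" using assms by blast
  define p where "p = int k ^ n"
  define x where "x = inflate n y"
  have "\<exists>u\<in>X. shift (int j * p) x = inflate n u" for j
    using shift_invariant_mult[OF shift_invariant_pow[OF inv]] y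
    unfolding x_def p_def shift_invariant_def by blast
  then obtain u where u: "\<And>j. shift (int j * p) x = inflate n (u j)" by metis
  \<comment> \<open>There are more shifts than letters, so two of them start with the same block;
    the distance of these shifts is a period along that block.\<close>
  have "\<not> inj_on (\<lambda>j. u j 0) {..?d}"
  proof
    assume "inj_on (\<lambda>j. u j 0) {..?d}"
    then have "card {..?d} \<le> ?d" by (rule card_inj_on_le) auto
    then show False by simp
  qed
  then obtain j1 j2 where j: "j1 < j2" "j2 \<le> ?d" "u j1 0 = u j2 0"
    unfolding inj_on_def by (metis atMost_iff linorder_neqE_nat)
  have x: "x (i + int j * p) = col n i (u j 0)" if "0 \<le> i" "i < int L ^ n" for i j
  proof -
    have "x (i + int j * p) = inflate n (u j) i" using fun_cong[OF u] by (simp only: shift_def)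
    also have "\<dots> = col n i (u j 0)" using inflate_block[OF that, of "u j" 0] by simp
    finally show ?thesis .
  qed
  define q where "q = int (j2 - j1) * p"
  have p0: "0 < p" using assms unfolding p_def by simp
  have "q \<le> int ?d * p" unfolding q_def using j p0 by (intro mult_right_mono) auto
  then have "q \<le> int L ^ n'" using q unfolding p_def by linarith
  moreover have "0 < q" unfolding q_def using j p0 by simp
  moreover have "x \<in> X" unfolding x_def using y by (rule inflate_in_X)
  moreover have "x (i + q) = x i" if "int j1 * p \<le> i" "i \<le> int j1 * p + int C * int L ^ n'" for i
  proof -
    let ?i = "i - int j1 * p"
    have "0 \<le> ?i" "?i < int L ^ n" using that CN by linarith+
    note e = x[OF this]
    have "i + q = ?i + int j2 * p" unfolding q_def using j by (simp add: of_nat_diff algebra_simps)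
    then have "x (i + q) = col n ?i (u j2 0)" using e[of j2] by (simp only:)
    then show ?thesis using e[of j1] j(3) by simp
  qed
  ultimately show False using no_long_period[OF C, of x q n' "int j1 * p"] by blast
qed

text \<open>The residue of k mod L would preserve \<theta>(X), so it is 0; then one level of
  inflation cancels and k div L is treated in the same way.\<close>

lemma cutting_unique:
  assumes "y \<in> X" "y' \<in> X" "shift k (inflate n y) = inflate n y'"
  shows "int L ^ n dvd k"
  using assms
proof (induction n arbitrary: k)
  case (Suc n)
  have inf: "inflate (Suc n) z = inflate 1 (inflate n z)" for z
    by (simp add: inflate_inflate)
  let ?q = "k div int L" and ?r = "k mod int L"
  have "k = ?r + ?q * int L ^ 1" by (metis add.commute div_mult_mod_eq power_one_right)
  then have eq: "shift ?r (inflate 1 (shift ?q (inflate n y))) = inflate 1 (inflate n y')"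
    using Suc.prems(3) unfolding inf inflate_shift shift_shift by metis
  then have "shift_invariant 1 ?r"
    using Suc.prems by (meson shift_invariant_if_eq shift_in_subst_space inflate_in_X)
  moreover have "?r = int (nat ?r)" "nat ?r < L" using two_le_L by (simp_all add: nat_less_iff)
  ultimately have "?r = 0" using not_shift_invariant[of "nat ?r"] Suc.prems(1) by (cases "nat ?r = 0") auto
  then have "shift ?q (inflate n y) = inflate n y'"
    using eq by (simp only: shift_0) (rule inflate_inj)
  then have "int L ^ n dvd ?q" using Suc by blast
  then have "int L ^ n * int L dvd ?q * int L" by (rule mult_dvd_mono) simp
  moreover have "?q * int L = k" using \<open>?r = 0\<close> by auto
  ultimately have "int L ^ n * int L dvd k" by (simp only:)
  then show ?case by (simp add: mult.commute)
qed simp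

text \<open>Implied by proximality in either direction, so one argument serves both.\<close>

definition agree_long :: "(int \<Rightarrow> 'a) \<Rightarrow> (int \<Rightarrow> 'a) \<Rightarrow> bool" where
  "agree_long x x' \<longleftrightarrow> (\<forall>m. \<exists>t. \<forall>i. t \<le> i \<and> i \<le> t + m \<longrightarrow> x i = x' i)"

text \<open>The two offsets both lie in [0, L^n), and long agreement makes their difference a shift
  preserving \<theta>^n(X), hence a multiple of L^n.\<close>

lemma agree_long_cuts:
  assumes X: "x \<in> X" "x' \<in> X" and ag: "agree_long x x'"
  shows "\<exists>i y y'. x = shift i (inflate n y) \<and> x' = shift i (inflate n y')"
proof -
  let ?N = "int L ^ n"
  obtain i y where y: "0 \<le> i" "i < ?N" "y \<in> X" "x = shift i (inflate n y)"
    using desubstitute[OF X(1)] by blast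
  obtain i' y' where y': "0 \<le> i'" "i' < ?N" "y' \<in> X" "x' = shift i' (inflate n y')"
    using desubstitute[OF X(2)] by blast
  have "shift_invariant n (i - i')"
  proof (rule shift_invariant_if_agree)
    fix m
    obtain t where t: "\<forall>j. t \<le> j \<and> j \<le> t + m \<longrightarrow> x j = x' j"
      using ag unfolding agree_long_def by blast
    have "inflate n y (j + (i - i')) = inflate n y' j" if "t + i' \<le> j" "j \<le> t + i' + m" for j
    proof -
      have "x (j - i') = x' (j - i')" using t that by simp
      then show ?thesis unfolding y(4) y'(4) shift_def by (simp add: algebra_simps)
    qed
    then show "\<exists>y\<in>X. \<exists>y'\<in>X. \<exists>t. \<forall>j. t \<le> j \<and> j \<le> t + m \<longrightarrow> inflate n y (j + (i - i')) = inflate n y' j"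
      using y y' by blast
  qed
  then obtain u where "u \<in> X" "shift (i - i') (inflate n y) = inflate n u"
    using y(3) unfolding shift_invariant_def by blast
  then have "?N dvd i - i'" using y(3) cutting_unique by blast
  then have "i mod ?N = i' mod ?N" by (simp add: mod_eq_dvd_iff)
  then have "i = i'" using y y' by simp
  then show ?thesis using y y' by blast
qed

text \<open>At a level with t' - t < L^n, the places t and t' lie in the same block or in adjacent
  ones. Any place between them shares its block with one of them, and agreement fills
  blocks.\<close>

lemma agree_between:
  assumes X: "x \<in> X" "x' \<in> X" and ag: "agree_long x x'"
    and t: "t \<le> s" "s \<le> t'" "x t = x' t" "x t' = x' t'"
  shows "x s = x' s"
proof -
  define n where "n = nat (t' - t)"
  let ?N = "int L ^ n"
  have "n < L ^ n" using two_le_L by (simp add: power_gt_expt)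
  then have "int n < int (L ^ n)" by (simp only: of_nat_less_iff)
  then have N: "t' - t < ?N" unfolding n_def using t by simp
  obtain i y y' where y: "x = shift i (inflate n y)" "x' = shift i (inflate n y')"
    using agree_long_cuts[OF X ag] by blast
  have eq: "x j = x' j \<longleftrightarrow> y ((j + i) div ?N) = y' ((j + i) div ?N)" for j
    unfolding y shift_def inflate_eq_iff ..
  have "(t' + i) div ?N \<le> (t + i + ?N) div ?N" using N by (intro zdiv_mono1 pow_pos) simp
  moreover have "(t + i + ?N) div ?N = (t + i) div ?N + 1" by simp
  moreover have "(t + i) div ?N \<le> (s + i) div ?N" "(s + i) div ?N \<le> (t' + i) div ?N"
    using t by (auto intro!: zdiv_mono1 pow_pos)
  ultimately have "(s + i) div ?N = (t + i) div ?N \<or> (s + i) div ?N = (t' + i) div ?N" by linarith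
  then show ?thesis using t(3,4) unfolding eq by metis
qed

end

section \<open>Topology and metrics\<close>

text \<open>For fixed \<open>x\<close> these cylinders form a neighbourhood base, uniformly in
  \<open>x\<close>; all topological statements are reduced to them.\<close>

definition agree :: "int \<Rightarrow> (int \<Rightarrow> 'a) \<Rightarrow> (int \<Rightarrow> 'a) \<Rightarrow> bool" where
  "agree m x y \<longleftrightarrow> (\<forall>i. \<bar>i\<bar> \<le> m \<longrightarrow> x i = y i)"

lemma agree_refl [simp]: "agree m x x"
  by (simp add: agree_def)

lemma agree_sym: "agree m x y \<Longrightarrow> agree m y x"
  by (simp add: agree_def)

lemma agree_trans: "agree m x y \<Longrightarrow> agree m y z \<Longrightarrow> agree m x z"
  by (simp add: agree_def)

lemma agree_mono: "agree m x y \<Longrightarrow> k \<le> m \<Longrightarrow> agree k x y"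
  by (simp add: agree_def)

lemma openin_full_shift:
  "openin (product_topology (\<lambda>_::int. discrete_topology UNIV) UNIV) U \<longleftrightarrow>
    (\<forall>x\<in>U. \<exists>m. \<forall>y. agree m x y \<longrightarrow> y \<in> U)"
  unfolding openin_product_topology_alt
proof (intro ball_cong refl iffI)
  fix x
  assume "\<exists>V. finite {i \<in> UNIV. V i \<noteq> topspace (discrete_topology UNIV)} \<and>
    (\<forall>i\<in>UNIV. openin (discrete_topology UNIV) (V i)) \<and> x \<in> Pi\<^sub>E UNIV V \<and> Pi\<^sub>E UNIV V \<subseteq> U"
  then obtain V where V: "finite {i. V i \<noteq> UNIV}" "x \<in> Pi UNIV V" "Pi UNIV V \<subseteq> U"
    by (auto simp: PiE_UNIV_domain)
  from finite_imageI[OF V(1), of abs] obtain m where m: "\<And>i. V i \<noteq> UNIV \<Longrightarrow> \<bar>i\<bar> \<le> m"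
    using finite_has_maximal2 by (metis (mono_tags, lifting) Max_ge image_eqI mem_Collect_eq)
  have "y \<in> U" if "agree m x y" for y
  proof -
    have "y i \<in> V i" for i
    proof (cases "V i = UNIV")
      case False
      then have "y i = x i" using m that by (simp add: agree_def)
      then show ?thesis using V(2) by auto
    qed simp
    then show ?thesis using V(3) by auto
  qed
  then show "\<exists>m. \<forall>y. agree m x y \<longrightarrow> y \<in> U" by blast
next
  fix x
  assume "\<exists>m. \<forall>y. agree m x y \<longrightarrow> y \<in> U"
  then obtain m where m: "\<And>y. agree m x y \<Longrightarrow> y \<in> U" by blast
  define V where "V i = (if \<bar>i\<bar> \<le> m then {x i} else UNIV)" for i
  have "{i. V i \<noteq> UNIV} \<subseteq> {-m..m}" by (auto simp: V_def)
  then have "finite {i. V i \<noteq> UNIV}" by (rule finite_subset) simp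
  moreover have "x \<in> Pi UNIV V" by (simp add: V_def)
  moreover have "Pi UNIV V \<subseteq> U"
  proof
    fix y assume y: "y \<in> Pi UNIV V"
    have "y i = x i" if "\<bar>i\<bar> \<le> m" for i
    proof -
      have "y i \<in> V i" using y by auto
      then show ?thesis using that by (simp add: V_def)
    qed
    then show "y \<in> U" by (intro m) (simp add: agree_def)
  qed
  ultimately show "\<exists>V. finite {i \<in> UNIV. V i \<noteq> topspace (discrete_topology UNIV)} \<and>
    (\<forall>i\<in>UNIV. openin (discrete_topology UNIV) (V i)) \<and> x \<in> Pi\<^sub>E UNIV V \<and> Pi\<^sub>E UNIV V \<subseteq> U"
    by (intro exI[of _ V]) (auto simp: PiE_UNIV_domain)
qed

lemma openin_subst_topology:
  "openin (subst_topology \<theta>) U \<longleftrightarrow>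
    U \<subseteq> subst_space \<theta> \<and> (\<forall>x\<in>U. \<exists>m. \<forall>y\<in>subst_space \<theta>. agree m x y \<longrightarrow> y \<in> U)"
  unfolding subst_topology_def openin_subtopology
proof (intro iffI)
  assume "\<exists>T. openin (product_topology (\<lambda>_. discrete_topology UNIV) UNIV) T \<and> U = T \<inter> subst_space \<theta>"
  then show "U \<subseteq> subst_space \<theta> \<and> (\<forall>x\<in>U. \<exists>m. \<forall>y\<in>subst_space \<theta>. agree m x y \<longrightarrow> y \<in> U)"
    unfolding openin_full_shift by blast
next
  assume U: "U \<subseteq> subst_space \<theta> \<and> (\<forall>x\<in>U. \<exists>m. \<forall>y\<in>subst_space \<theta>. agree m x y \<longrightarrow> y \<in> U)"
  then obtain m where m: "\<And>x y. x \<in> U \<Longrightarrow> y \<in> subst_space \<theta> \<Longrightarrow> agree (m x) x y \<Longrightarrow> y \<in> U"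
    by metis
  let ?T = "{y. \<exists>x\<in>U. agree (m x) x y}"
  have "openin (product_topology (\<lambda>_. discrete_topology UNIV) UNIV) ?T"
    unfolding openin_full_shift using agree_trans by blast
  moreover have "U = ?T \<inter> subst_space \<theta>" using m U by (auto intro: agree_refl)
  ultimately show "\<exists>T. openin (product_topology (\<lambda>_. discrete_topology UNIV) UNIV) T \<and> U = T \<inter> subst_space \<theta>"
    by blast
qed

lemma openin_cylinder: "openin (subst_topology \<theta>) {y \<in> subst_space \<theta>. agree m x y}"
  unfolding openin_subst_topology using agree_trans by blast

lemma compact_full_shift:
  "compact_space (product_topology (\<lambda>_::int. discrete_topology (UNIV :: 'a::finite set)) UNIV)"
  by (simp add: compact_space_product_topology compact_space_discrete_topology)

lemma compact_subst_topology: "compact_space (subst_topology (\<theta> :: 'a::finite \<Rightarrow> 'a list))"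
proof -
  have "openin (product_topology (\<lambda>_. discrete_topology UNIV) UNIV) (- subst_space \<theta>)"
    unfolding openin_full_shift
  proof
    fix x assume "x \<in> - subst_space \<theta>"
    then obtain p q where pq: "\<not> allowed \<theta> (map x [p..q])" by (auto simp: subst_space_def)
    have "y \<in> - subst_space \<theta>" if "agree (\<bar>p\<bar> + \<bar>q\<bar>) x y" for y
    proof -
      have eq: "map x [p..q] = map y [p..q]" using that by (auto simp: agree_def)
      show ?thesis using pq unfolding eq subst_space_def by blast
    qed
    then show "\<exists>m. \<forall>y. agree m x y \<longrightarrow> y \<in> - subst_space \<theta>" by blast
  qed
  then have "closedin (product_topology (\<lambda>_. discrete_topology UNIV) UNIV) (subst_space \<theta>)"
    by (simp add: closedin_def Compl_eq_Diff_UNIV)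
  then show ?thesis unfolding subst_topology_def
    using compact_full_shift closedin_compact_space compact_space_subtopology by blast
qed

lemma Hausdorff_subst_topology: "Hausdorff_space (subst_topology \<theta>)"
  unfolding subst_topology_def
  by (intro Hausdorff_space_subtopology) (simp add: Hausdorff_space_product_topology)

text \<open>A Lebesgue number argument, since \<open>d\<close> is an arbitrary compatible metric.
  The radii are halved: if x is within \<open>r a\<close> of a centre and y within
  \<open>e \<le> r a\<close> of x, both lie in the ball of radius \<open>2 * r a\<close>.\<close>

lemma metric_small_imp_agree:
  fixes \<theta> :: "'a::finite \<Rightarrow> 'a list"
  assumes d: "induces_subst_topology \<theta> d"
  shows "\<exists>e>0. \<forall>x\<in>subst_space \<theta>. \<forall>y\<in>subst_space \<theta>. d x y < e \<longrightarrow> agree m x y"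
proof -
  interpret Metric_space "subst_space \<theta>" d using d by (simp add: induces_subst_topology_def)
  have top: "mtopology = subst_topology \<theta>" using d by (simp add: induces_subst_topology_def)
  have "\<exists>r>0. \<forall>y\<in>subst_space \<theta>. d a y < 2 * r \<longrightarrow> agree m a y" if a: "a \<in> subst_space \<theta>" for a
  proof -
    have "openin mtopology {y \<in> subst_space \<theta>. agree m a y}" unfolding top by (rule openin_cylinder)
    then obtain r where "r > 0" "mball a r \<subseteq> {y \<in> subst_space \<theta>. agree m a y}"
      using a unfolding openin_mtopology by force
    then show ?thesis using a by (intro exI[of _ "r / 2"]) (auto simp: in_mball)
  qed
  then obtain r where r: "\<And>a. a \<in> subst_space \<theta> \<Longrightarrow> r a > 0"
    "\<And>a y. a \<in> subst_space \<theta> \<Longrightarrow> y \<in> subst_space \<theta> \<Longrightarrow> d a y < 2 * r a \<Longrightarrow> agree m a y"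
    by metis
  have "compactin mtopology (subst_space \<theta>)"
    using compact_subst_topology[of \<theta>] unfolding top compact_space_def topspace_subst_topology .
  then have "\<exists>F. finite F \<and> F \<subseteq> (\<lambda>a. mball a (r a)) ` subst_space \<theta> \<and> subst_space \<theta> \<subseteq> \<Union>F"
    by (rule compactinD) (use r in auto)
  then obtain F where F: "finite F" "F \<subseteq> (\<lambda>a. mball a (r a)) ` subst_space \<theta>" "subst_space \<theta> \<subseteq> \<Union>F"
    by blast
  obtain B where B: "finite B" "B \<subseteq> subst_space \<theta>" "subst_space \<theta> \<subseteq> (\<Union>a\<in>B. mball a (r a))"
    using finite_subset_image[OF F(1,2)] F(3) by auto
  \<comment> \<open>The extra 1 keeps the minimum defined for empty \<open>B\<close>, the case of an
    empty space.\<close>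
  define e where "e = Min (insert 1 (r ` B))"
  have e: "0 < e" "\<And>a. a \<in> B \<Longrightarrow> e \<le> r a" unfolding e_def using B r by auto
  have "agree m x y" if xy: "x \<in> subst_space \<theta>" "y \<in> subst_space \<theta>" "d x y < e" for x y
  proof -
    obtain a where a: "a \<in> B" "d a x < r a" using B(3) xy(1) by (auto simp: in_mball)
    then have A: "a \<in> subst_space \<theta>" using B by blast
    have "d a y \<le> d a x + d x y" by (rule triangle[OF A xy(1,2)])
    then have "d a y < 2 * r a" "d a x < 2 * r a" using a e(2)[OF a(1)] xy(3) r(1)[OF A] by linarith+
    then have "agree m a y" "agree m a x" using r(2)[OF A xy(2)] r(2)[OF A xy(1)] by simp_all
    then show ?thesis using agree_trans[OF agree_sym] by blast
  qed
  then show ?thesis using e(1) by blast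
qed

lemma agree_imp_metric_small:
  fixes \<theta> :: "'a::finite \<Rightarrow> 'a list"
  assumes d: "induces_subst_topology \<theta> d" and e: "0 < e"
  shows "\<exists>m. \<forall>x\<in>subst_space \<theta>. \<forall>y\<in>subst_space \<theta>. agree m x y \<longrightarrow> d x y < e"
proof -
  interpret Metric_space "subst_space \<theta>" d using d by (simp add: induces_subst_topology_def)
  have top: "mtopology = subst_topology \<theta>" using d by (simp add: induces_subst_topology_def)
  have "\<exists>m. \<forall>y\<in>subst_space \<theta>. agree m a y \<longrightarrow> d a y < e / 2" if a: "a \<in> subst_space \<theta>" for a
  proof -
    have "openin (subst_topology \<theta>) (mball a (e / 2))" using openin_mball unfolding top .
    moreover have "a \<in> mball a (e / 2)" using a e by simp
    ultimately show ?thesis unfolding openin_subst_topology by (fastforce simp: in_mball)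
  qed
  then obtain m where m: "\<And>a y. a \<in> subst_space \<theta> \<Longrightarrow> y \<in> subst_space \<theta> \<Longrightarrow> agree (m a) a y \<Longrightarrow> d a y < e / 2"
    by metis
  let ?U = "\<lambda>a. {y \<in> subst_space \<theta>. agree (m a) a y}"
  have "compactin (subst_topology \<theta>) (subst_space \<theta>)"
    using compact_subst_topology[of \<theta>] unfolding compact_space_def topspace_subst_topology .
  then have "\<exists>F. finite F \<and> F \<subseteq> ?U ` subst_space \<theta> \<and> subst_space \<theta> \<subseteq> \<Union>F"
    by (rule compactinD) (auto intro: openin_cylinder)
  then obtain F where F: "finite F" "F \<subseteq> ?U ` subst_space \<theta>" "subst_space \<theta> \<subseteq> \<Union>F"
    by blast
  obtain B where B: "finite B" "B \<subseteq> subst_space \<theta>" "subst_space \<theta> \<subseteq> (\<Union>a\<in>B. ?U a)"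
    using finite_subset_image[OF F(1,2)] F(3) by auto
  define M where "M = Max (insert 0 (m ` B))"
  have M: "\<And>a. a \<in> B \<Longrightarrow> m a \<le> M" unfolding M_def using B by auto
  have "d x y < e" if xy: "x \<in> subst_space \<theta>" "y \<in> subst_space \<theta>" "agree M x y" for x y
  proof -
    obtain a where a: "a \<in> B" "agree (m a) a x" using B(3) xy(1) by auto
    then have A: "a \<in> subst_space \<theta>" using B by blast
    have "agree (m a) a y" using a(2) agree_mono[OF xy(3) M[OF a(1)]] by (rule agree_trans)
    then have "d a y < e / 2" "d a x < e / 2" using m[OF A xy(2)] m[OF A xy(1) a(2)] by simp_all
    moreover have "d x y \<le> d x a + d a y" by (rule triangle[OF xy(1) A xy(2)])
    ultimately show ?thesis by (simp add: commute)
  qed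
  then show ?thesis by blast
qed

text \<open>For a sign \<open>s\<close>, the relations below are forward (\<open>s = 1\<close>) or backward (\<open>s = - 1\<close>)
  proximality and asymptoticity.\<close>

definition proximal :: "int \<Rightarrow> (int \<Rightarrow> 'a) \<Rightarrow> (int \<Rightarrow> 'a) \<Rightarrow> bool" where
  "proximal s x x' \<longleftrightarrow> (\<forall>m. \<exists>t::nat. agree m (shift (s * int t) x) (shift (s * int t) x'))"

definition asymptotic :: "int \<Rightarrow> (int \<Rightarrow> 'a) \<Rightarrow> (int \<Rightarrow> 'a) \<Rightarrow> bool" where
  "asymptotic s x x' \<longleftrightarrow> (\<exists>n. \<forall>i\<ge>n. x (s * i) = x' (s * i))"

lemma metric_proximal:
  fixes \<theta> :: "'a::finite \<Rightarrow> 'a list"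
  assumes d: "induces_subst_topology \<theta> d" and X: "x \<in> subst_space \<theta>" "x' \<in> subst_space \<theta>"
    and inf: "(INF t::nat. d (shift (s * int t) x) (shift (s * int t) x')) = 0"
  shows "proximal s x x'"
  unfolding proximal_def
proof
  fix m
  obtain e where e: "e > 0" "\<And>x y. x \<in> subst_space \<theta> \<Longrightarrow> y \<in> subst_space \<theta> \<Longrightarrow> d x y < e \<Longrightarrow> agree m x y"
    using metric_small_imp_agree[OF d] by blast
  obtain t :: nat where t: "d (shift (s * int t) x) (shift (s * int t) x') < e"
    using cInf_lessD[of "range (\<lambda>t::nat. d (shift (s * int t) x) (shift (s * int t) x'))" e] inf e(1) by auto
  show "\<exists>t::nat. agree m (shift (s * int t) x) (shift (s * int t) x')"
    using e(2)[OF X[THEN shift_in_subst_space] t] by blast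
qed

lemma asymptotic_metric:
  fixes \<theta> :: "'a::finite \<Rightarrow> 'a list"
  assumes d: "induces_subst_topology \<theta> d" and X: "x \<in> subst_space \<theta>" "x' \<in> subst_space \<theta>"
    and s: "s * s = 1" and as: "asymptotic s x x'"
  shows "(\<lambda>t::nat. d (shift (s * int t) x) (shift (s * int t) x')) \<longlonglongrightarrow> 0"
proof (rule LIMSEQ_I)
  interpret Metric_space "subst_space \<theta>" d using d by (simp add: induces_subst_topology_def)
  fix e :: real assume "0 < e"
  then obtain m where m: "\<And>x y. x \<in> subst_space \<theta> \<Longrightarrow> y \<in> subst_space \<theta> \<Longrightarrow> agree m x y \<Longrightarrow> d x y < e"
    using agree_imp_metric_small[OF d \<open>0 < e\<close>] by blast
  obtain n where n: "\<And>i. n \<le> i \<Longrightarrow> x (s * i) = x' (s * i)" using as unfolding asymptotic_def by blast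
  have "norm (d (shift (s * int t) x) (shift (s * int t) x') - 0) < e" if t: "nat (n + m) \<le> t" for t
  proof -
    have "agree m (shift (s * int t) x) (shift (s * int t) x')"
      unfolding agree_def shift_def
    proof (intro allI impI)
      fix i assume i: "\<bar>i\<bar> \<le> m"
      have "\<bar>s\<bar> = 1" using s by (auto simp: zmult_eq_1_iff)
      then have "\<bar>s * i\<bar> \<le> m" using i by (simp add: abs_mult)
      then have "n \<le> s * i + int t" using t by linarith
      then have "x (s * (s * i + int t)) = x' (s * (s * i + int t))" by (rule n)
      moreover have "s * (s * i + int t) = i + s * int t" using s by (simp add: distrib_left mult.assoc[symmetric])
      ultimately show "x (i + s * int t) = x' (i + s * int t)" by simp
    qed
    then have "d (shift (s * int t) x) (shift (s * int t) x') < e" by (rule m[OF X[THEN shift_in_subst_space]])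
    then show ?thesis by simp
  qed
  then show "\<exists>no. \<forall>t\<ge>no. norm (d (shift (s * int t) x) (shift (s * int t) x') - 0) < e" by blast
qed

lemma asymptotic_metric_INF:
  fixes \<theta> :: "'a::finite \<Rightarrow> 'a list"
  assumes d: "induces_subst_topology \<theta> d" and X: "x \<in> subst_space \<theta>" "x' \<in> subst_space \<theta>"
    and s: "s * s = 1" and as: "asymptotic s x x'"
  shows "(INF t::nat. d (shift (s * int t) x) (shift (s * int t) x')) = 0"
proof -
  interpret Metric_space "subst_space \<theta>" d using d by (simp add: induces_subst_topology_def)
  have bdd: "bdd_below (range (\<lambda>t::nat. d (shift (s * int t) x) (shift (s * int t) x')))"
    by (rule bdd_belowI[of _ 0]) auto
  show ?thesis
  proof (rule antisym)
    show "(INF t::nat. d (shift (s * int t) x) (shift (s * int t) x')) \<le> 0"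
      using asymptotic_metric[OF assms] by (rule LIMSEQ_le_const) (auto intro: cINF_lower[OF bdd])
    show "0 \<le> (INF t::nat. d (shift (s * int t) x) (shift (s * int t) x'))"
      by (rule cINF_greatest) auto
  qed
qed

section \<open>Existence and rigidity of asymptotic pairs\<close>

context bijective_substitution begin

text \<open>Compactness: for each M, some point carries a word of some \<theta>^k(a) on [-M, M], and
  these conditions are closed and nested.\<close>

lemma X_nonempty: "X \<noteq> {}"
proof -
  define Q where "Q M x \<longleftrightarrow> (\<exists>k a c. \<forall>i. \<bar>i\<bar> \<le> int M \<longrightarrow>
    0 \<le> i + c \<and> i + c < int L ^ k \<and> x i = col k (i + c) a)" for M and x :: "int \<Rightarrow> 'a"
  let ?T = "product_topology (\<lambda>_::int. discrete_topology (UNIV :: 'a set)) UNIV"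
  \<comment> \<open>Serves twice: with \<open>M' = M\<close> for closedness and with
    \<open>y = x\<close> for nestedness.\<close>
  have Q_mono: "Q M y" if Q: "Q M' x" and "M \<le> M'" "agree (int M) x y" for M M' x y
  proof -
    obtain k a c where c: "\<forall>i. \<bar>i\<bar> \<le> int M' \<longrightarrow> 0 \<le> i + c \<and> i + c < int L ^ k \<and> x i = col k (i + c) a"
      using Q unfolding Q_def by (elim exE)
    have "0 \<le> i + c \<and> i + c < int L ^ k \<and> y i = col k (i + c) a" if i: "\<bar>i\<bar> \<le> int M" for i
    proof -
      have "\<bar>i\<bar> \<le> int M'" using i \<open>M \<le> M'\<close> by linarith
      note c[rule_format, OF this]
      moreover have "x i = y i" using \<open>agree (int M) x y\<close> i by (simp add: agree_def)
      ultimately show ?thesis by simp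
    qed
    then show ?thesis unfolding Q_def by (intro exI[of _ k] exI[of _ a] exI[of _ c] allI impI)
  qed
  have "(\<Inter>M. Collect (Q M)) \<noteq> {}"
  proof (rule compact_space_imp_nest[OF compact_full_shift])
    fix M
    have "openin ?T (- Collect (Q M))"
      unfolding openin_full_shift using Q_mono[of M _ M] agree_sym by blast
    then show "closedin ?T (Collect (Q M))" by (simp add: closedin_def Compl_eq_Diff_UNIV)
    fix a :: 'a
    define K where "K = 2 * M + 1"
    have "K < L ^ K" using two_le_L by (simp add: power_gt_expt)
    then have "int K < int (L ^ K)" by (simp only: of_nat_less_iff)
    then have K: "2 * int M < int L ^ K" unfolding K_def[THEN arg_cong[of _ _ int]] by simp
    have *: "0 \<le> i + int M \<and> i + int M < int L ^ K \<and> col K (i + int M) a = col K (i + int M) a"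
      if "\<bar>i\<bar> \<le> int M" for i
      using that K by auto
    have "Q M (\<lambda>i. col K (i + int M) a)"
      unfolding Q_def by (intro exI[of _ K] exI[of _ a] exI[of _ "int M"] allI impI) (rule *)
    then show "Collect (Q M) \<noteq> {}" by blast
  next
    show "decseq (\<lambda>M. Collect (Q M))"
      unfolding decseq_def using Q_mono agree_refl by blast
  qed
  then obtain x where x: "\<And>M. Q M x" by blast
  have "x \<in> X"
    unfolding in_X_iff
  proof (intro allI)
    fix p q
    obtain k a c where c: "\<forall>i. \<bar>i\<bar> \<le> int (nat (\<bar>p\<bar> + \<bar>q\<bar>)) \<longrightarrow> 0 \<le> i + c \<and> i + c < int L ^ k \<and> x i = col k (i + c) a"
      using x[of "nat (\<bar>p\<bar> + \<bar>q\<bar>)"] unfolding Q_def by (elim exE)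
    have "0 \<le> i + c \<and> i + c < int L ^ k \<and> x i = col k (i + c) a" if "p \<le> i \<and> i \<le> q" for i
      using that by (intro c[rule_format]) linarith
    then show "\<exists>k a c. \<forall>i. p \<le> i \<and> i \<le> q \<longrightarrow> 0 \<le> i + c \<and> i + c < int L ^ k \<and> x i = col k (i + c) a"
      by (intro exI[of _ k] exI[of _ a] exI[of _ c] allI impI)
  qed
  then show ?thesis by blast
qed

text \<open>By compactness it suffices to agree on \<open>M\<close> places, for each
  \<open>M\<close>. If that failed for some \<open>M\<close>, any \<open>M\<close> letters would
  determine the adjacent letter at \<open>- s\<close>; two equal words in one point would then
  coincide along a whole half line, which \<open>no_long_period\<close> excludes.\<close>

lemma ex_asymptotic_pair:
  fixes s :: int
  assumes s: "s = 1 \<or> s = - 1"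
  shows "\<exists>x\<in>X. \<exists>x'\<in>X. x \<noteq> x' \<and> (\<forall>i\<ge>0. x (s * i) = x' (s * i))"
proof -
  \<comment> \<open>Disagreement at a fixed place is a closed condition, so the limit pair stays
    distinct.\<close>
  let ?P = "\<lambda>M x x'. x (- s) \<noteq> x' (- s) \<and> (\<forall>i. 0 \<le> i \<and> i < int M \<longrightarrow> x (s * i) = x' (s * i))"
  let ?K = "\<lambda>M. {(x, x') \<in> X \<times> X. ?P M x x'}"
  let ?T = "prod_topology (subst_topology \<theta>) (subst_topology \<theta>)"
  have ss: "s * s = 1" "\<bar>s\<bar> = 1" using s by auto
  have "(\<Inter>M. ?K M) \<noteq> {}"
  proof (rule compact_space_imp_nest)
    show "compact_space ?T" by (simp add: compact_space_prod_topology compact_subst_topology)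
    fix M
    have "openin ?T (X \<times> X - ?K M)"
      unfolding openin_prod_topology_alt
    proof (intro allI impI)
      fix x x' assume xx: "(x, x') \<in> X \<times> X - ?K M"
      let ?U = "\<lambda>x. {y \<in> X. agree (int M + 1) x y}"
      have "?U x \<times> ?U x' \<subseteq> X \<times> X - ?K M"
      proof (rule subsetI, rule ccontr)
        fix w assume w: "w \<in> ?U x \<times> ?U x'" "w \<notin> X \<times> X - ?K M"
        obtain y y' where yy: "w = (y, y')" by (cases w)
        have y: "agree (int M + 1) x y" "agree (int M + 1) x' y'"
          and P: "y (- s) \<noteq> y' (- s)" "\<forall>i. 0 \<le> i \<and> i < int M \<longrightarrow> y (s * i) = y' (s * i)"
          using w unfolding yy by auto
        have eq: "x i = y i" "x' i = y' i" if "\<bar>i\<bar> \<le> int M + 1" for i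
          using y that by (auto simp: agree_def)
        have "x (- s) \<noteq> x' (- s)" using P(1) eq[of "- s"] ss by simp
        moreover have "x (s * i) = x' (s * i)" if "0 \<le> i" "i < int M" for i
          using P(2) eq[of "s * i"] that ss by (simp add: abs_mult)
        ultimately show False using xx by auto
      qed
      then show "\<exists>U V. openin (subst_topology \<theta>) U \<and> openin (subst_topology \<theta>) V \<and>
          x \<in> U \<and> x' \<in> V \<and> U \<times> V \<subseteq> X \<times> X - ?K M"
        using openin_cylinder[of \<theta> "int M + 1" x] openin_cylinder[of \<theta> "int M + 1" x'] xx
        by (intro exI[of _ "?U x"] exI[of _ "?U x'"]) auto
    qed
    then show "closedin ?T (?K M)" by (auto simp: closedin_def topspace_subst_topology)
    show "?K M \<noteq> {}"
    proof
      assume "?K M = {}"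
      then have det: "x (- s) = x' (- s)"
        if "x \<in> X" "x' \<in> X" "\<And>i. 0 \<le> i \<Longrightarrow> i < int M \<Longrightarrow> x (s * i) = x' (s * i)" for x x'
        using that by blast
      obtain x where x: "x \<in> X" using X_nonempty by blast
      let ?w = "\<lambda>j::nat. map (\<lambda>i. x (int j + s * int i)) [0..<M]"
      have "\<not> inj ?w"
      proof
        assume "inj ?w"
        moreover have "finite (range ?w)"
          by (rule finite_subset[OF _ finite_lists_length_eq[of UNIV M]]) auto
        ultimately show False using finite_imageD infinite_UNIV_nat by blast
      qed
      then obtain j1' j2' where "j1' \<noteq> j2'" "?w j1' = ?w j2'" unfolding inj_def by blast
      then obtain j1 j2 where j: "j1 < j2" "?w j1 = ?w j2" by (metis linorder_neqE_nat)
      \<comment> \<open>The two copies start with \<open>M\<close> equal letters; each use of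
        \<open>det\<close> extends the coincidence by one letter against direction
        \<open>s\<close>.\<close>
      have past: "\<forall>i. 0 \<le> i \<and> i < int M + int t \<longrightarrow> x (int j1 - s * int t + s * i) = x (int j2 - s * int t + s * i)" for t
      proof (induction t)
        case 0
        have "x (int j1 + s * int i) = x (int j2 + s * int i)" if "i < M" for i
          using j(2) that by (auto simp: map_eq_conv)
        then show ?case by (auto dest: zero_le_imp_eq_int)
      next
        case (Suc t)
        let ?x = "shift (int j1 - s * int t) x" and ?x' = "shift (int j2 - s * int t) x"
        have "?x (- s) = ?x' (- s)"
        proof (rule det)
          fix i assume "0 \<le> i" "i < int M"
          then show "?x (s * i) = ?x' (s * i)" using Suc.IH by (simp add: shift_def add.commute)
        qed (use x in \<open>auto intro: shift_in_subst_space\<close>)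
        then have 0: "x (int j1 - s * int (Suc t)) = x (int j2 - s * int (Suc t))"
          by (simp add: shift_def algebra_simps)
        show ?case
        proof (intro allI impI)
          fix i assume i: "0 \<le> i \<and> i < int M + int (Suc t)"
          show "x (int j1 - s * int (Suc t) + s * i) = x (int j2 - s * int (Suc t) + s * i)"
          proof (cases "i = 0")
            case True
            then show ?thesis using 0 by simp
          next
            case False
            have "x (int j1 - s * int t + s * (i - 1)) = x (int j2 - s * int t + s * (i - 1))"
              using Suc.IH False i by simp
            then show ?thesis by (simp add: algebra_simps)
          qed
        qed
      qed
      define q where "q = int j2 - int j1"
      have q: "0 < q" using j unfolding q_def by simp
      have per: "x (p + q) = x p" if p: "1 \<le> s * (int j1 - p)" for p
      proof -
        let ?t = "nat (s * (int j1 - p))"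
        have "s * int ?t = int j1 - p" using p ss by (simp add: mult.assoc[symmetric])
        then have "int j1 - s * int ?t = p" "int j2 - s * int ?t = p + q"
          unfolding q_def by linarith+
        moreover have "x (int j1 - s * int ?t) = x (int j2 - s * int ?t)"
          using past[of ?t] p by (auto dest: spec[of _ 0])
        ultimately show ?thesis by (simp only:)
      qed
      obtain C where C: "\<forall>n. \<forall>x\<in>X. \<forall>z\<in>X. \<forall>t p. \<exists>j\<ge>t. j + int L ^ n \<le> t + int C * int L ^ n \<and>
         (\<forall>r. 0 \<le> r \<and> r \<le> int L ^ n \<longrightarrow> x (j + r) = z (p + r))"
        using linearly_recurrent by blast
      define n where "n = nat q"
      have "n < L ^ n" using two_le_L by (simp add: power_gt_expt)
      then have "int n < int (L ^ n)" by (simp only: of_nat_less_iff)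
      then have qn: "q \<le> int L ^ n" unfolding n_def using q by simp
      let ?W = "int C * int L ^ n"
      \<comment> \<open>The period is known on one side of \<open>int j1\<close> only, so the
        recurrence window is placed to the left for s = 1 and to the right for s = -1.\<close>
      have "\<exists>t. \<forall>p. t \<le> p \<and> p \<le> t + ?W \<longrightarrow> 1 \<le> s * (int j1 - p)"
        using s
      proof
        assume "s = 1"
        then show ?thesis by (intro exI[of _ "int j1 - 1 - ?W"]) auto
      next
        assume "s = - 1"
        then show ?thesis by (intro exI[of _ "int j1 + 1"]) auto
      qed
      then obtain t where "\<And>p. t \<le> p \<Longrightarrow> p \<le> t + ?W \<Longrightarrow> 1 \<le> s * (int j1 - p)" by blast
      then show False using no_long_period[OF C x q qn, of t] per by blast
    qed
  next
    show "decseq ?K" unfolding decseq_def by auto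
  qed
  then obtain w where w: "w \<in> (\<Inter>M. ?K M)" by blast
  obtain x x' where ww: "w = (x, x')" by (cases w)
  have xx: "(x, x') \<in> ?K M" for M using w unfolding ww by blast
  then have X: "x \<in> X" "x' \<in> X" "x (- s) \<noteq> x' (- s)" by auto
  have "x (s * i) = x' (s * i)" if "0 \<le> i" for i
    using xx[of "nat (i + 1)"] that by simp
  then show ?thesis using X by metis
qed

lemma proximal_imp_asymptotic:
  assumes X: "x \<in> X" "x' \<in> X" and s: "s = 1 \<or> s = - 1" and prox: "proximal s x x'"
  shows "asymptotic s x x'"
proof -
  have P: "\<exists>t::nat. \<forall>i. \<bar>i\<bar> \<le> m \<longrightarrow> x (i + s * int t) = x' (i + s * int t)" for m
    using prox unfolding proximal_def agree_def shift_def by blast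
  have ag: "agree_long x x'"
    unfolding agree_long_def
  proof
    fix m
    obtain t :: nat where t: "\<And>i. \<bar>i\<bar> \<le> \<bar>m\<bar> \<Longrightarrow> x (i + s * int t) = x' (i + s * int t)"
      using P by blast
    have "x i = x' i" if "s * int t \<le> i" "i \<le> s * int t + m" for i
      using t[of "i - s * int t"] that by simp
    then show "\<exists>t. \<forall>i. t \<le> i \<and> i \<le> t + m \<longrightarrow> x i = x' i" by blast
  qed
  obtain t0 :: nat where t0: "x (s * int t0) = x' (s * int t0)"
    using P[of 0] by auto
  have "x (s * i) = x' (s * i)" if i: "int t0 \<le> i" for i
  proof -
    \<comment> \<open>A window of this radius around \<open>s * int t\<close> contains
      \<open>s * (i + int t)\<close>, a place of agreement at or beyond
      \<open>s * i\<close>.\<close>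
    obtain t :: nat where t: "\<And>j. \<bar>j\<bar> \<le> \<bar>i\<bar> \<Longrightarrow> x (j + s * int t) = x' (j + s * int t)"
      using P by blast
    have t': "x (s * (i + int t)) = x' (s * (i + int t))"
      using t[of "s * i"] s by (auto simp: algebra_simps)
    show ?thesis
      using s
    proof
      assume "s = 1"
      then show ?thesis
        using agree_between[OF X ag, of "s * int t0" "s * i" "s * (i + int t)"] t0 t' i by simp
    next
      assume "s = - 1"
      then show ?thesis
        using agree_between[OF X ag, of "s * (i + int t)" "s * i" "s * int t0"] t0 t' i by simp
    qed
  qed
  then show ?thesis unfolding asymptotic_def by blast
qed

lemma two_sided_asymptotic_imp_eq:
  assumes X: "x \<in> X" "x' \<in> X" and as: "asymptotic 1 x x'" "asymptotic (- 1) x x'"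
  shows "x = x'"
proof
  fix i
  obtain n where n: "\<And>i. n \<le> i \<Longrightarrow> x i = x' i" using as unfolding asymptotic_def by auto
  obtain k where k: "\<And>i. k \<le> i \<Longrightarrow> x (- i) = x' (- i)" using as unfolding asymptotic_def by auto
  have "agree_long x x'" unfolding agree_long_def using n by blast
  then show "x i = x' i"
    using agree_between[OF X, of "- max k (- i)" i "max n i"] n[of "max n i"] k[of "max k (- i)"] by simp
qed

end

section \<open>Compact semigroups\<close>

text \<open>The Ellis-Numakura argument. In a minimal closed subsemigroup C with a in C, the set C a
  is a closed subsemigroup, hence equals C. So {b in C. b a = a} is nonempty; it is again a closed
  subsemigroup, hence equals C, and a a = a.\<close>

lemma compact_semigroup_has_idempotent:
  assumes haus: "Hausdorff_space T" and comp: "compactin T S" and ne: "S \<noteq> {}"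
    and sg: "semigroup_on S m"
    and cont: "\<And>a. a \<in> S \<Longrightarrow> continuous_map T T (\<lambda>h. m h a)"
  shows "\<exists>e\<in>S. m e e = e"
proof -
  have cl: "m a b \<in> S" if "a \<in> S" "b \<in> S" for a b
    using sg that by (simp add: semigroup_on_def)
  have as: "m (m a b) c = m a (m b c)" if "a \<in> S" "b \<in> S" "c \<in> S" for a b c
    using sg that by (simp add: semigroup_on_def)
  define A where "A = {C. C \<noteq> {} \<and> closedin T C \<and> C \<subseteq> S \<and> (\<forall>a\<in>C. \<forall>b\<in>C. m a b \<in> C)}"
  have "S \<in> A"
    unfolding A_def using ne cl compactin_imp_closedin[OF haus comp] by blast
  \<comment> \<open>Zorn's lemma yields maximal sets, so it is applied to complements.\<close>
  have "\<exists>D\<in>uminus ` A. \<forall>D'\<in>uminus ` A. D \<subseteq> D' \<longrightarrow> D' = D"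
  proof (rule subset_Zorn_nonempty)
    show "uminus ` A \<noteq> {}" using \<open>S \<in> A\<close> by blast
    fix \<C> assume \<C>: "\<C> \<noteq> {}" "subset.chain (uminus ` A) \<C>"
    let ?U = "uminus ` \<C>"
    have UA: "?U \<subseteq> A" using \<C>(2) unfolding subset_chain_def by auto
    have lin: "C \<subseteq> D \<or> D \<subseteq> C" if "C \<in> ?U" "D \<in> ?U" for C D
    proof -
      have "- C \<in> \<C>" "- D \<in> \<C>" using that by auto
      then have "- C \<subseteq> - D \<or> - D \<subseteq> - C" using \<C>(2) unfolding subset_chain_def by blast
      then show ?thesis by auto
    qed
    have "S \<inter> \<Inter>?U \<noteq> {}"
    proof -
      have "S \<inter> \<Inter>\<F> \<noteq> {}" if F: "finite \<F>" "\<F> \<subseteq> ?U" for \<F>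
      proof (cases "\<F> = {}")
        case False
        have "subset.chain A \<F>"
          unfolding subset_chain_def
          by (intro conjI ballI order_trans[OF F(2) UA] lin subsetD[OF F(2)])
        then have "\<Inter>\<F> \<in> \<F>" using F(1) False by (intro Inter_in_chain)
        then have "\<Inter>\<F> \<in> A" using F(2) UA by blast
        then show ?thesis unfolding A_def by blast
      qed (use ne in simp)
      moreover have "\<forall>C\<in>?U. closedin T C" using UA unfolding A_def by blast
      ultimately show ?thesis using comp unfolding compactin_fip by blast
    qed
    moreover have "closedin T (\<Inter>?U)" using UA \<C>(1) unfolding A_def by (intro closedin_Inter) auto
    moreover have "\<Inter>?U \<subseteq> S"
    proof -
      obtain D where D: "D \<in> ?U" using \<C>(1) by blast
      then have "D \<subseteq> S" using subsetD[OF UA D] by (simp add: A_def)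
      with Inter_lower[OF D] show ?thesis by (rule order_trans)
    qed
    moreover have "m a b \<in> \<Inter>?U" if ab: "a \<in> \<Inter>?U" "b \<in> \<Inter>?U" for a b
    proof (rule InterI)
      fix D assume D: "D \<in> ?U"
      then have "D \<in> A" using UA by (rule subsetD[rotated])
      then show "m a b \<in> D" using InterD[OF ab(1) D] InterD[OF ab(2) D] by (simp add: A_def)
    qed
    ultimately have "\<Inter>?U \<in> A" by (auto simp only: A_def mem_Collect_eq)
    moreover have "\<Union>\<C> = - \<Inter>?U" by auto
    ultimately show "\<Union>\<C> \<in> uminus ` A" by blast
  qed
  then obtain C where C: "C \<in> A" and Cmin: "\<And>C'. C' \<in> A \<Longrightarrow> C' \<subseteq> C \<Longrightarrow> C' = C"
    by (metis (no_types, lifting) Compl_subset_Compl_iff double_complement image_iff)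
  have C': "C \<subseteq> S" "closedin T C" "\<And>a b. a \<in> C \<Longrightarrow> b \<in> C \<Longrightarrow> m a b \<in> C"
    using C unfolding A_def by blast+
  obtain a where a: "a \<in> C" using C unfolding A_def by blast
  then have aS: "a \<in> S" using C' by blast
  have "compactin T C" using closed_compactin[OF comp] C' by blast
  then have "compactin T ((\<lambda>h. m h a) ` C)" using cont[OF aS] by (rule image_compactin)
  then have "closedin T ((\<lambda>h. m h a) ` C)" by (rule compactin_imp_closedin[OF haus])
  moreover have "(\<lambda>h. m h a) ` C \<subseteq> C" using C' a by blast
  moreover have "m (m h a) (m k a) \<in> (\<lambda>h. m h a) ` C" if hk: "h \<in> C" "k \<in> C" for h k
  proof -
    have "m (m h a) (m k a) = m (m (m h a) k) a"
      using as[of "m h a" k a] cl C'(1) hk a by (metis subsetD)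
    then show ?thesis using C'(3) hk a by blast
  qed
  ultimately have "(\<lambda>h. m h a) ` C \<in> A" unfolding A_def using C' a by auto
  then have img: "(\<lambda>h. m h a) ` C = C" using Cmin C' a by blast
  let ?B = "{b \<in> C. m b a = a}"
  have "closedin T {b \<in> topspace T. m b a \<in> {a}}"
    using cont[OF aS] by (rule closedin_continuous_map_preimage)
      (use haus aS compactin_subset_topspace[OF comp] in \<open>auto intro: closedin_Hausdorff_singleton\<close>)
  moreover have "?B = C \<inter> {b \<in> topspace T. m b a \<in> {a}}"
    using closedin_subset[OF C'(2)] by auto
  ultimately have "closedin T ?B" using C'(2) by (metis closedin_Int)
  moreover have "?B \<noteq> {}"
  proof -
    have "a \<in> (\<lambda>h. m h a) ` C" unfolding img by (rule a)
    then show ?thesis by auto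
  qed
  moreover have "m (m b c) a = a" if "b \<in> ?B" "c \<in> ?B" for b c
    using that as[of b c a] C'(1) aS by auto
  ultimately have "?B \<in> A" unfolding A_def using C' by auto
  then have "?B = C" by (rule Cmin) auto
  then show ?thesis using a aS by blast
qed

text \<open>Left simplicity: an idempotent u = h g gives f = f u = (f h) g. Regularity: if h f is
  idempotent, then e = f h is idempotent with e f = f. Solve e = g0 f and put g = e g0, so that g f
  = e. Then f g is idempotent, so e (f g) = e, whereas e f = f gives e (f g) = f g; hence f g = e =
  g f.\<close>

lemma
  assumes sg: "semigroup_on S m"
    and idem: "\<And>f. f \<in> S \<Longrightarrow> \<exists>h\<in>S. m (m h f) (m h f) = m h f"
    and right_id: "\<And>f u. f \<in> S \<Longrightarrow> u \<in> S \<Longrightarrow> m u u = u \<Longrightarrow> m f u = f"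
  shows left_simple_of_right_identities: "f \<in> S \<Longrightarrow> g \<in> S \<Longrightarrow> \<exists>h\<in>S. f = m h g"
    and completely_regular_of_right_identities:
      "f \<in> S \<Longrightarrow> \<exists>g\<in>S. m (m f g) f = f \<and> m (m g f) g = g \<and> m f g = m g f"
proof -
  have cl: "m a b \<in> S" if "a \<in> S" "b \<in> S" for a b
    using sg that by (simp add: semigroup_on_def)
  have as: "m (m a b) c = m a (m b c)" if "a \<in> S" "b \<in> S" "c \<in> S" for a b c
    using sg that by (simp add: semigroup_on_def)
  have ls: "\<exists>h\<in>S. f = m h g" if f: "f \<in> S" and g: "g \<in> S" for f g
  proof -
    obtain h where h: "h \<in> S" "m (m h g) (m h g) = m h g" using idem[OF g] by blast
    then have "f = m f (m h g)" using right_id[OF f cl[OF h(1) g]] by simp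
    also have "\<dots> = m (m f h) g" using as[OF f h(1) g] by simp
    finally show ?thesis using cl[OF f h(1)] by blast
  qed
  then show "f \<in> S \<Longrightarrow> g \<in> S \<Longrightarrow> \<exists>h\<in>S. f = m h g" .
  assume f: "f \<in> S"
  obtain h where h: "h \<in> S" "m (m h f) (m h f) = m h f" using idem[OF f] by blast
  define e where "e = m f h"
  have e: "e \<in> S" unfolding e_def using cl f h by blast
  have fhf: "m f (m h f) = f" using right_id[OF f cl[OF h(1) f] h(2)] .
  have ef: "m e f = f" unfolding e_def using as f h fhf by simp
  have ee: "m e e = e"
  proof -
    have "m e (m f h) = m (m e f) h" using as[OF e f h(1)] by simp
    then show ?thesis unfolding ef e_def[symmetric] .
  qed
  obtain g0 where g0: "g0 \<in> S" "e = m g0 f" using ls[OF e f] by blast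
  define g where "g = m e g0"
  have g: "g \<in> S" unfolding g_def using cl e g0 by blast
  have gf: "m g f = e" unfolding g_def using as[OF e g0(1) f] g0(2) ee by simp
  have eg: "m e g = g" unfolding g_def using as[OF e e g0(1)] ee by simp
  have fe: "m f e = f" using right_id[OF f e ee] .
  have fg: "m f g \<in> S" using cl f g by blast
  have "m (m f g) (m f g) = m f (m (m g f) g)" using as cl f g by simp
  then have "m (m f g) (m f g) = m f g" unfolding gf eg .
  then have "m e (m f g) = e" using right_id[OF e fg] by blast
  moreover have "m e (m f g) = m f g" using as[OF e f g] ef by simp
  ultimately have "m f g = e" by simp
  then show "\<exists>g\<in>S. m (m f g) f = f \<and> m (m g f) g = g \<and> m f g = m g f"
    using g gf eg ef by (intro bexI[of _ g]) auto
qed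

section \<open>The Ellis semigroup\<close>

text \<open>Allowing an arbitrary set of times covers the Ellis semigroup, the tails of Z and
  bounded ranges at once.\<close>

definition limit_maps :: "('a \<Rightarrow> 'a list) \<Rightarrow> int set \<Rightarrow> ((int \<Rightarrow> 'a) \<Rightarrow> (int \<Rightarrow> 'a)) set" where
  "limit_maps \<theta> A = product_topology (\<lambda>_. subst_topology \<theta>) (subst_space \<theta>) closure_of
     ((\<lambda>t. restrict (shift t) (subst_space \<theta>)) ` A)"

lemma Ellis_eq_limit_maps: "Ellis \<theta> = limit_maps \<theta> UNIV"
  by (simp add: Ellis_def shift_maps_def limit_maps_def)

lemma topspace_maps:
  "topspace (product_topology (\<lambda>_. subst_topology \<theta>) (subst_space \<theta>)) = subst_space \<theta> \<rightarrow>\<^sub>E subst_space \<theta>"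
  by (simp add: topspace_subst_topology)

text \<open>A basic neighbourhood for pointwise convergence tests finitely many points, so one
  window size serves them all.\<close>

lemma limit_maps_iff:
  "f \<in> limit_maps \<theta> A \<longleftrightarrow> f \<in> subst_space \<theta> \<rightarrow>\<^sub>E subst_space \<theta> \<and>
    (\<forall>F m. finite F \<and> F \<subseteq> subst_space \<theta> \<longrightarrow> (\<exists>t\<in>A. \<forall>x\<in>F. agree m (f x) (shift t x)))"
  (is "?l \<longleftrightarrow> ?r")
proof
  let ?X = "subst_space \<theta>" and ?T = "product_topology (\<lambda>_. subst_topology \<theta>) (subst_space \<theta>)"
  assume l: ?l
  then have f: "f \<in> ?X \<rightarrow>\<^sub>E ?X" unfolding limit_maps_def in_closure_of topspace_maps by blast
  have "\<exists>t\<in>A. \<forall>x\<in>F. agree m (f x) (shift t x)" if F: "finite F" "F \<subseteq> ?X" for F m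
  proof -
    define U where "U x = (if x \<in> F then {y \<in> ?X. agree m (f x) y} else ?X)" for x
    have "openin ?T (Pi\<^sub>E ?X U)"
      unfolding openin_product_topology_alt
    proof (rule ballI, intro exI conjI)
      fix g assume "g \<in> Pi\<^sub>E ?X U"
      then show "g \<in> Pi\<^sub>E ?X U" .
      have "{i \<in> ?X. U i \<noteq> topspace (subst_topology \<theta>)} \<subseteq> F"
        by (auto simp: U_def topspace_subst_topology)
      then show "finite {i \<in> ?X. U i \<noteq> topspace (subst_topology \<theta>)}"
        using F(1) by (rule finite_subset)
      show "\<forall>i\<in>?X. openin (subst_topology \<theta>) (U i)"
        unfolding U_def using openin_cylinder openin_topspace[of "subst_topology \<theta>"]
        by (auto simp: topspace_subst_topology)
    qed simp
    moreover have "f \<in> Pi\<^sub>E ?X U" using f by (auto simp: U_def PiE_iff)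
    ultimately obtain t where t: "t \<in> A" "restrict (shift t) ?X \<in> Pi\<^sub>E ?X U"
      using l unfolding limit_maps_def in_closure_of by blast
    have "agree m (f x) (shift t x)" if "x \<in> F" for x
    proof -
      have x: "x \<in> ?X" using F that by blast
      have "restrict (shift t) ?X x \<in> U x" using t(2) x by (rule PiE_mem)
      then show ?thesis using that x by (simp add: U_def)
    qed
    then show ?thesis using t(1) by blast
  qed
  then show ?r using f by blast
next
  let ?X = "subst_space \<theta>" and ?T = "product_topology (\<lambda>_. subst_topology \<theta>) (subst_space \<theta>)"
  assume r: ?r
  have shifts: "\<exists>t\<in>A. restrict (shift t) ?X \<in> U" if U: "f \<in> U" "openin ?T U" for U
  proof -
    obtain V where V: "finite {x \<in> ?X. V x \<noteq> ?X}" "\<forall>x\<in>?X. openin (subst_topology \<theta>) (V x)"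
      "f \<in> Pi\<^sub>E ?X V" "Pi\<^sub>E ?X V \<subseteq> U"
      using U(2)[unfolded openin_product_topology_alt topspace_subst_topology, rule_format, OF U(1)]
      by (elim exE conjE)
    let ?F = "{x \<in> ?X. V x \<noteq> ?X}"
    have "\<exists>m. \<forall>y\<in>?X. agree m (f x) y \<longrightarrow> y \<in> V x" if x: "x \<in> ?X" for x
      using bspec[OF V(2) x] PiE_mem[OF V(3) x] unfolding openin_subst_topology by blast
    then obtain m where m: "\<And>x y. x \<in> ?X \<Longrightarrow> y \<in> ?X \<Longrightarrow> agree (m x) (f x) y \<Longrightarrow> y \<in> V x"
      by metis
    define M where "M = Max (insert 0 (m ` ?F))"
    have M: "m x \<le> M" if "x \<in> ?F" for x
      unfolding M_def using V(1) that by (intro Max_ge) auto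
    have "?F \<subseteq> ?X" by auto
    then have "\<exists>t\<in>A. \<forall>x\<in>?F. agree M (f x) (shift t x)"
      using r[THEN conjunct2, rule_format, of ?F M] V(1) by blast
    then obtain t where t: "t \<in> A" "\<And>x. x \<in> ?F \<Longrightarrow> agree M (f x) (shift t x)" by blast
    have "restrict (shift t) ?X \<in> Pi\<^sub>E ?X V"
    proof (rule PiE_I)
      fix x assume x: "x \<in> ?X"
      show "restrict (shift t) ?X x \<in> V x"
      proof (cases "V x = ?X")
        case True
        then show ?thesis using x shift_in_subst_space by auto
      next
        case False
        then have "x \<in> ?F" using x by blast
        then have "agree (m x) (f x) (shift t x)" using agree_mono[OF t(2) M] by blast
        then show ?thesis using m[OF x shift_in_subst_space[OF x]] x by simp
      qed
    qed simp
    then show ?thesis using V(4) t(1) by blast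
  qed
  show ?l
    unfolding limit_maps_def in_closure_of topspace_maps
  proof (intro conjI allI impI)
    show "f \<in> ?X \<rightarrow>\<^sub>E ?X" using r by (rule conjunct1)
    fix U assume "f \<in> U \<and> openin ?T U"
    then obtain t where "t \<in> A" "restrict (shift t) ?X \<in> U" using shifts by meson
    then show "\<exists>g. g \<in> (\<lambda>t. restrict (shift t) ?X) ` A \<and> g \<in> U" by blast
  qed
qed

lemma limit_maps_PiE: "f \<in> limit_maps \<theta> A \<Longrightarrow> f \<in> subst_space \<theta> \<rightarrow>\<^sub>E subst_space \<theta>"
  by (simp add: limit_maps_iff)

lemma limit_maps_in: "f \<in> limit_maps \<theta> A \<Longrightarrow> x \<in> subst_space \<theta> \<Longrightarrow> f x \<in> subst_space \<theta>"
  by (auto dest: limit_maps_PiE)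

lemma limit_maps_mono: "A \<subseteq> B \<Longrightarrow> limit_maps \<theta> A \<subseteq> limit_maps \<theta> B"
  unfolding limit_maps_def by (intro closure_of_mono image_mono)

lemma limit_maps_Un: "limit_maps \<theta> (A \<union> B) = limit_maps \<theta> A \<union> limit_maps \<theta> B"
  unfolding limit_maps_def image_Un by (rule closure_of_Un)

lemma shift_in_limit_maps: "t \<in> A \<Longrightarrow> restrict (shift t) (subst_space \<theta>) \<in> limit_maps \<theta> A"
  unfolding limit_maps_iff by (auto intro!: bexI[of _ t] shift_in_subst_space)

lemma Hausdorff_maps:
  "Hausdorff_space (product_topology (\<lambda>_. subst_topology \<theta>) (subst_space \<theta>))"
  by (simp add: Hausdorff_space_product_topology Hausdorff_subst_topology)

lemma compact_maps:
  "compact_space (product_topology (\<lambda>_. subst_topology (\<theta> :: 'a::finite \<Rightarrow> 'a list)) (subst_space \<theta>))"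
  by (simp add: compact_space_product_topology compact_subst_topology)

lemma limit_maps_finite:
  assumes "finite A"
  shows "limit_maps \<theta> A \<subseteq> shift_maps \<theta>"
proof -
  have "limit_maps \<theta> A = (\<lambda>t. restrict (shift t) (subst_space \<theta>)) ` A"
    unfolding limit_maps_def using assms
    by (intro closure_of_closedin closedin_Hausdorff_finite Hausdorff_maps)
       (auto simp: topspace_subst_topology intro: shift_in_subst_space)
  then show ?thesis unfolding shift_maps_def by auto
qed

text \<open>The order of choice matters: \<open>a\<close> approximates \<open>f\<close> on the image
  of \<open>F\<close> under \<open>g\<close>, and only then is \<open>b\<close> chosen, on a window
  enlarged by |a| because the shift by \<open>a\<close> moves the window.\<close>

lemma compose_in_limit_maps:
  assumes f: "f \<in> limit_maps \<theta> A" and g: "g \<in> limit_maps \<theta> B"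
    and AB: "\<And>a b. a \<in> A \<Longrightarrow> b \<in> B \<Longrightarrow> a + b \<in> C"
  shows "compose (subst_space \<theta>) f g \<in> limit_maps \<theta> C"
  unfolding limit_maps_iff
proof (intro conjI allI impI)
  show "compose (subst_space \<theta>) f g \<in> subst_space \<theta> \<rightarrow>\<^sub>E subst_space \<theta>"
    using limit_maps_in[OF f] limit_maps_in[OF g] by (auto simp: compose_def)
  fix F m assume F: "finite F \<and> F \<subseteq> subst_space \<theta>"
  have gF: "finite (g ` F) \<and> g ` F \<subseteq> subst_space \<theta>" using F limit_maps_in[OF g] by blast
  obtain a where a: "a \<in> A" "\<And>x. x \<in> g ` F \<Longrightarrow> agree m (f x) (shift a x)"
    using f gF unfolding limit_maps_iff by meson
  obtain b where b: "b \<in> B" "\<And>x. x \<in> F \<Longrightarrow> agree (m + \<bar>a\<bar>) (g x) (shift b x)"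
    using g F unfolding limit_maps_iff by meson
  have "agree m (compose (subst_space \<theta>) f g x) (shift (a + b) x)" if x: "x \<in> F" for x
  proof -
    have "agree m (f (g x)) (shift a (g x))" using a(2) x by blast
    moreover have "agree m (shift a (g x)) (shift a (shift b x))"
      using b(2)[OF x] by (simp add: agree_def shift_def[of a])
    ultimately have "agree m (f (g x)) (shift (a + b) x)" unfolding shift_shift by (rule agree_trans)
    then show ?thesis using x F by (auto simp: compose_def)
  qed
  then show "\<exists>t\<in>C. \<forall>x\<in>F. agree m (compose (subst_space \<theta>) f g x) (shift t x)"
    using AB[OF a(1) b(1)] by blast
qed

lemma continuous_compose_right:
  assumes g: "g \<in> subst_space \<theta> \<rightarrow>\<^sub>E subst_space \<theta>"
  defines "T \<equiv> product_topology (\<lambda>_. subst_topology \<theta>) (subst_space \<theta>)"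
  shows "continuous_map T T (\<lambda>f. compose (subst_space \<theta>) f g)"
  unfolding T_def continuous_map_componentwise
proof (intro conjI ballI)
  fix x assume x: "x \<in> subst_space \<theta>"
  have "continuous_map (product_topology (\<lambda>_. subst_topology \<theta>) (subst_space \<theta>)) (subst_topology \<theta>) (\<lambda>f. f (g x))"
    by (rule continuous_map_product_projection) (use g x in auto)
  then show "continuous_map (product_topology (\<lambda>_. subst_topology \<theta>) (subst_space \<theta>)) (subst_topology \<theta>)
      (\<lambda>f. compose (subst_space \<theta>) f g x)"
    using x by (simp add: compose_def)
qed (auto simp: compose_def)

section \<open>Limits of the shifts in one direction\<close>

context bijective_substitution begin

text \<open>A nested intersection of compact sets, which gives compactness and nonemptiness.\<close>

definition omega_limits :: "int \<Rightarrow> ((int \<Rightarrow> 'a) \<Rightarrow> (int \<Rightarrow> 'a)) set" where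
  "omega_limits s = (\<Inter>n::nat. limit_maps \<theta> {t. int n \<le> s * t})"

lemma omega_limits_subset_Ellis: "omega_limits s \<subseteq> Ellis \<theta>"
proof -
  have "omega_limits s \<subseteq> limit_maps \<theta> {t. int 0 \<le> s * t}" unfolding omega_limits_def by (rule INT_lower) simp
  also have "\<dots> \<subseteq> limit_maps \<theta> UNIV" by (rule limit_maps_mono) simp
  finally show ?thesis unfolding Ellis_eq_limit_maps .
qed

lemma Ellis_PiE: "f \<in> Ellis \<theta> \<Longrightarrow> f \<in> X \<rightarrow>\<^sub>E X"
  unfolding Ellis_eq_limit_maps by (rule limit_maps_PiE)

lemma omega_limits_PiE: "f \<in> omega_limits s \<Longrightarrow> f \<in> X \<rightarrow>\<^sub>E X"
  using omega_limits_subset_Ellis Ellis_PiE by blast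

lemma Ellis_compose: "f \<in> Ellis \<theta> \<Longrightarrow> g \<in> Ellis \<theta> \<Longrightarrow> compose X f g \<in> Ellis \<theta>"
  unfolding Ellis_eq_limit_maps by (rule compose_in_limit_maps) auto

lemma shift_maps_subset_Ellis: "shift_maps \<theta> \<subseteq> Ellis \<theta>"
  unfolding shift_maps_def Ellis_eq_limit_maps using shift_in_limit_maps by blast

text \<open>Z is the union of two tails and a bounded range; closure commutes with finite unions,
  and the bounded range contributes only shifts.\<close>

lemma Ellis_not_shift_omega_limits:
  assumes f: "f \<in> Ellis \<theta>" "f \<notin> shift_maps \<theta>"
  shows "f \<in> omega_limits 1 \<or> f \<in> omega_limits (- 1)"
proof (rule ccontr)
  assume "\<not> ?thesis"
  then obtain n1 n2 :: nat where n: "f \<notin> limit_maps \<theta> {t. int n1 \<le> 1 * t}" "f \<notin> limit_maps \<theta> {t. int n2 \<le> - 1 * t}"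
    unfolding omega_limits_def by blast
  have "UNIV = ({t. int n1 \<le> 1 * t} \<union> {t. int n2 \<le> - 1 * t}) \<union> {- int n2<..<int n1}"
    by auto
  then have "f \<in> limit_maps \<theta> (({t. int n1 \<le> 1 * t} \<union> {t. int n2 \<le> - 1 * t}) \<union> {- int n2<..<int n1})"
    using f(1) unfolding Ellis_eq_limit_maps by simp
  then have "f \<in> limit_maps \<theta> {- int n2<..<int n1}" using n unfolding limit_maps_Un by blast
  then show False using limit_maps_finite[of "{- int n2<..<int n1}" \<theta>] f(2) by blast
qed

text \<open>Far shifts approximate \<open>f\<close> at both points simultaneously, so equal values
  bring the two orbits together on every window. This is proximality, which already implies
  asymptoticity.\<close>

lemma omega_limits_eq_iff:
  assumes s: "s = 1 \<or> s = - 1" and f: "f \<in> omega_limits s" and x: "x \<in> X" "x' \<in> X"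
  shows "f x = f x' \<longleftrightarrow> asymptotic s x x'"
proof -
  have ap: "\<exists>t. int n \<le> s * t \<and> agree m (f x) (shift t x) \<and> agree m (f x') (shift t x')" for n m
  proof -
    have "f \<in> limit_maps \<theta> {t. int n \<le> s * t}" using f unfolding omega_limits_def by blast
    then have "\<exists>t\<in>{t. int n \<le> s * t}. \<forall>y\<in>{x, x'}. agree m (f y) (shift t y)"
      unfolding limit_maps_iff using x by (elim conjE allE[of _ "{x, x'}"] allE[of _ m]) simp
    then show ?thesis by auto
  qed
  show ?thesis
  proof
    assume eq: "f x = f x'"
    have "proximal s x x'"
      unfolding proximal_def
    proof
      fix m
      obtain t where t: "int 0 \<le> s * t" "agree m (f x) (shift t x)" "agree m (f x') (shift t x')"
        using ap[of 0 m] by blast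
      have "agree m (shift t x) (shift t x')"
        using agree_trans[OF agree_sym[OF t(2)]] t(3) unfolding eq by blast
      moreover have "t = s * int (nat (s * t))" using t(1) s by auto
      ultimately show "\<exists>t::nat. agree m (shift (s * int t) x) (shift (s * int t) x')" by metis
    qed
    then show "asymptotic s x x'" using proximal_imp_asymptotic[OF x s] by blast
  next
    assume "asymptotic s x x'"
    then obtain n where n: "\<And>i. n \<le> i \<Longrightarrow> x (s * i) = x' (s * i)" unfolding asymptotic_def by blast
    show "f x = f x'"
    proof
      fix i
      \<comment> \<open>So far out that the place \<open>i + t\<close> lies in the half line of
        agreement whatever the sign of \<open>i\<close>.\<close>
      obtain t where t: "int (nat (n + \<bar>i\<bar>)) \<le> s * t" "agree \<bar>i\<bar> (f x) (shift t x)" "agree \<bar>i\<bar> (f x') (shift t x')"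
        using ap[of "nat (n + \<bar>i\<bar>)" "\<bar>i\<bar>"] by blast
      have "n + \<bar>i\<bar> \<le> s * t" using t(1) by linarith
      then have "n \<le> s * (i + t)" using s by auto
      then have "x (s * (s * (i + t))) = x' (s * (s * (i + t)))" by (rule n)
      moreover have "s * (s * (i + t)) = i + t" using s by auto
      ultimately show "f x i = f x' i" using t(2,3) by (simp add: agree_def shift_def)
    qed
  qed
qed

lemma omega_limits_not_inj:
  assumes s: "s = 1 \<or> s = - 1" and f: "f \<in> omega_limits s"
  shows "\<not> inj_on f X"
proof -
  obtain x x' where x: "x \<in> X" "x' \<in> X" "x \<noteq> x'" "\<forall>i\<ge>0. x (s * i) = x' (s * i)"
    using ex_asymptotic_pair[OF s] by blast
  then have "asymptotic s x x'" unfolding asymptotic_def by blast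
  then have "f x = f x'" using omega_limits_eq_iff[OF s f x(1,2)] by blast
  then show ?thesis using x unfolding inj_on_def by blast
qed

lemma shift_maps_bij:
  assumes "f \<in> shift_maps \<theta>"
  shows "inj_on f X" "f ` X = X"
proof -
  obtain t where f: "f = restrict (shift t) X" using assms unfolding shift_maps_def by blast
  have inv: "shift (- t) (shift t x) = x" "shift t (shift (- t) x) = x" for x :: "int \<Rightarrow> 'a"
    by (simp_all add: shift_shift shift_0)
  have "inj_on (shift t) X" by (rule inj_on_inverseI[of _ "shift (- t)"]) (rule inv(1))
  then show "inj_on f X" unfolding f by (auto simp: inj_on_def)
  show "f ` X = X"
  proof (intro equalityI subsetI)
    fix x assume "x \<in> X"
    then have "x = f (shift (- t) x)" "shift (- t) x \<in> X"
      unfolding f using inv(2) shift_in_subst_space by auto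
    then show "x \<in> f ` X" by blast
  qed (auto simp: f shift_in_subst_space)
qed

text \<open>Injectivity is a criterion for being a shift that can be followed through
  products.\<close>

lemma Ellis_cases:
  assumes "f \<in> Ellis \<theta>"
  shows "f \<notin> shift_maps \<theta> \<longleftrightarrow> \<not> inj_on f X"
    and "f \<notin> shift_maps \<theta> \<longleftrightarrow> f \<in> omega_limits 1 \<or> f \<in> omega_limits (- 1)"
  using assms Ellis_not_shift_omega_limits omega_limits_not_inj shift_maps_bij(1) by blast+

lemma compose_assoc_Ellis:
  assumes "h \<in> Ellis \<theta>"
  shows "compose X (compose X f g) h = compose X f (compose X g h)"
  using Ellis_PiE[OF assms] by (intro compose_assoc[symmetric]) auto

lemma semigroup_Ellis: "semigroup_on (Ellis \<theta>) (compose X)"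
  unfolding semigroup_on_def using Ellis_compose compose_assoc_Ellis by blast

lemma semigroup_omega_limits: "semigroup_on (omega_limits s) (compose X)"
  unfolding semigroup_on_def
proof (intro conjI ballI)
  fix f g assume fg: "f \<in> omega_limits s" "g \<in> omega_limits s"
  show "compose X f g \<in> omega_limits s"
    unfolding omega_limits_def
  proof
    fix n :: nat
    have "f \<in> limit_maps \<theta> {t. int n \<le> s * t}" "g \<in> limit_maps \<theta> {t. int n \<le> s * t}"
      using fg unfolding omega_limits_def by blast+
    then show "compose X f g \<in> limit_maps \<theta> {t. int n \<le> s * t}"
      by (rule compose_in_limit_maps) (auto simp: distrib_left)
  qed
  fix h assume "h \<in> omega_limits s"
  then show "compose X (compose X f g) h = compose X f (compose X g h)"
    using compose_assoc_Ellis omega_limits_subset_Ellis by blast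
qed

abbreviation maps_topology where
  "maps_topology \<equiv> product_topology (\<lambda>_. subst_topology \<theta>) X"

lemma closedin_omega_limits: "closedin maps_topology (omega_limits s)"
  unfolding omega_limits_def limit_maps_def by (intro closedin_Inter) auto

lemma compactin_omega_limits: "compactin maps_topology (omega_limits s)"
  using closedin_compact_space[OF compact_maps closedin_omega_limits] .

lemma omega_limits_nonempty:
  assumes s: "s = 1 \<or> s = - 1"
  shows "omega_limits s \<noteq> {}"
  unfolding omega_limits_def
proof (rule compact_space_imp_nest[OF compact_maps])
  fix n :: nat
  show "closedin maps_topology (limit_maps \<theta> {t. int n \<le> s * t})"
    unfolding limit_maps_def by simp
  have "s * int n \<in> {t. int n \<le> s * t}" using s by auto
  then have "restrict (shift (s * int n)) X \<in> limit_maps \<theta> {t. int n \<le> s * t}"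
    by (rule shift_in_limit_maps)
  then show "limit_maps \<theta> {t. int n \<le> s * t} \<noteq> {}" by (metis empty_iff)
next
  show "decseq (\<lambda>n. limit_maps \<theta> {t. int n \<le> s * t})"
    unfolding decseq_def by (auto intro!: limit_maps_mono)
qed

text \<open>The left ideal of multiples of \<open>f\<close> is a continuous image of a compact set,
  so Ellis-Numakura applies inside it.\<close>

lemma omega_limits_left_multiple_idempotent:
  assumes f: "f \<in> omega_limits s" and s: "s = 1 \<or> s = - 1"
  shows "\<exists>h\<in>omega_limits s. compose X (compose X h f) (compose X h f) = compose X h f"
proof -
  let ?K = "(\<lambda>h. compose X h f) ` omega_limits s"
  note sg = semigroup_omega_limits[of s, unfolded semigroup_on_def]
  have KD: "?K \<subseteq> omega_limits s" using sg f by blast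
  have "\<exists>e\<in>?K. compose X e e = e"
  proof (rule compact_semigroup_has_idempotent[where m = "compose X"])
    show "Hausdorff_space maps_topology" by (rule Hausdorff_maps)
    show "compactin maps_topology ?K"
      using image_compactin[OF compactin_omega_limits continuous_compose_right[OF omega_limits_PiE[OF f]]] .
    show "?K \<noteq> {}" using omega_limits_nonempty[OF s] by blast
    have closed: "compose X (compose X h f) (compose X k f) \<in> ?K" if hk: "h \<in> omega_limits s" "k \<in> omega_limits s" for h k
    proof -
      have "compose X (compose X h f) (compose X k f) = compose X (compose X (compose X h f) k) f"
        using compose_assoc_Ellis[of f] f omega_limits_subset_Ellis by (metis subsetD)
      moreover have "compose X (compose X h f) k \<in> omega_limits s" using sg f hk by blast
      ultimately show ?thesis by blast
    qed
    show "semigroup_on ?K (compose X)"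
      unfolding semigroup_on_def
    proof (intro conjI ballI)
      fix a b assume "a \<in> ?K" "b \<in> ?K"
      then show "compose X a b \<in> ?K" using closed by (elim imageE) simp
      fix c assume "c \<in> ?K"
      then have "c \<in> Ellis \<theta>" using KD omega_limits_subset_Ellis by blast
      then show "compose X (compose X a b) c = compose X a (compose X b c)"
        by (rule compose_assoc_Ellis)
    qed
    show "continuous_map maps_topology maps_topology (\<lambda>h. compose X h a)" if "a \<in> ?K" for a
      using that KD omega_limits_PiE by (intro continuous_compose_right) blast
  qed
  then show ?thesis by blast
qed

text \<open>Since u (u x) = u x, the map \<open>u\<close> identifies u x with x. They are therefore
  asymptotic, and \<open>f\<close> identifies them too.\<close>

lemma omega_limits_idempotent_right_identity:
  assumes s: "s = 1 \<or> s = - 1" and f: "f \<in> omega_limits s" and u: "u \<in> omega_limits s" "compose X u u = u"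
  shows "compose X f u = f"
proof
  fix x
  show "compose X f u x = f x"
  proof (cases "x \<in> X")
    case True
    have ux: "u x \<in> X" using omega_limits_PiE[OF u(1)] True by auto
    have "u (u x) = u x" using fun_cong[OF u(2), of x] True by (simp add: compose_def)
    then have "asymptotic s (u x) x" using omega_limits_eq_iff[OF s u(1) ux True] by blast
    then have "f (u x) = f x" using omega_limits_eq_iff[OF s f ux True] by blast
    then show ?thesis using True by (simp add: compose_def)
  next
    \<comment> \<open>Outside \<open>X\<close> both maps take the value
      \<open>undefined\<close>.\<close>
    case False
    then show ?thesis using omega_limits_PiE[OF f] by (auto simp: compose_def PiE_def extensional_def)
  qed
qed

lemma omega_limits_left_simple:
  assumes s: "s = 1 \<or> s = - 1" and "f \<in> omega_limits s" "g \<in> omega_limits s"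
  shows "\<exists>h\<in>omega_limits s. f = compose X h g"
  using left_simple_of_right_identities[OF semigroup_omega_limits omega_limits_left_multiple_idempotent[OF _ s]
      omega_limits_idempotent_right_identity[OF s]] assms(2,3) by blast

lemma completely_regular_Ellis: "completely_regular_semigroup (Ellis \<theta>) (compose X)"
  unfolding completely_regular_semigroup_def
proof (intro conjI ballI semigroup_Ellis)
  fix f assume f: "f \<in> Ellis \<theta>"
  let ?R = "\<lambda>g. compose X (compose X f g) f = f \<and> compose X (compose X g f) g = g \<and>
      compose X f g = compose X g f"
  have dir: "\<exists>g\<in>Ellis \<theta>. ?R g" if fs: "f \<in> omega_limits s" and s: "s = 1 \<or> s = - 1" for s
    using completely_regular_of_right_identities[OF semigroup_omega_limits
        omega_limits_left_multiple_idempotent[OF _ s] omega_limits_idempotent_right_identity[OF s] fs]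
      omega_limits_subset_Ellis by blast
  show "\<exists>g\<in>Ellis \<theta>. ?R g"
  proof (cases "f \<in> shift_maps \<theta>")
    case True
    then obtain t where t: "f = restrict (shift t) X" unfolding shift_maps_def by blast
    let ?g = "restrict (shift (- t)) X"
    have "?g \<in> Ellis \<theta>" using shift_maps_subset_Ellis unfolding shift_maps_def by blast
    moreover have "?R ?g"
      unfolding t by (auto simp: compose_def fun_eq_iff shift_in_subst_space shift_shift shift_0)
    ultimately show ?thesis by blast
  next
    case False
    then show ?thesis using Ellis_not_shift_omega_limits[OF f] dir by blast
  qed
qed

text \<open>An injective product has an injective right factor, which is a shift and hence onto; so
  the left factor is injective on all of \<open>X\<close> as well.\<close>

lemma not_inj_compose:
  assumes f: "f \<in> Ellis \<theta>" and g: "g \<in> Ellis \<theta>" and fg: "\<not> inj_on f X \<or> \<not> inj_on g X"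
  shows "\<not> inj_on (compose X f g) X"
proof
  assume inj: "inj_on (compose X f g) X"
  have "inj_on (f \<circ> g) X" using inj by (auto simp: inj_on_def compose_def)
  then have ginj: "inj_on g X" and finj: "inj_on f (g ` X)"
    by (auto dest: inj_on_imageI2 simp: inj_on_def)
  then have "g ` X = X" using Ellis_cases(1)[OF g] shift_maps_bij(2) by blast
  then show False using fg ginj finj by simp
qed

lemma kernel_Ellis: "is_kernel (Ellis \<theta>) (compose X) (Ellis \<theta> - shift_maps \<theta>)"
  (is "is_kernel _ _ ?M")
  unfolding is_kernel_def
proof (intro conjI allI impI)
  have M: "f \<in> ?M \<longleftrightarrow> f \<in> Ellis \<theta> \<and> \<not> inj_on f X" for f
    using Ellis_cases(1) by blast
  have dM: "omega_limits 1 \<subseteq> ?M" "omega_limits (- 1) \<subseteq> ?M"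
    using M omega_limits_subset_Ellis omega_limits_not_inj by blast+
  show "two_sided_ideal (Ellis \<theta>) (compose X) ?M"
    unfolding two_sided_ideal_def
  proof (intro conjI ballI)
    show "?M \<noteq> {}" using dM(1) omega_limits_nonempty[of 1] by blast
    show "?M \<subseteq> Ellis \<theta>" by blast
    fix f g assume fg: "f \<in> Ellis \<theta>" "g \<in> ?M"
    then have g: "g \<in> Ellis \<theta>" "\<not> inj_on g X" using M by blast+
    show "compose X f g \<in> ?M" "compose X g f \<in> ?M"
      unfolding M using Ellis_compose not_inj_compose fg(1) g by blast+
  qed
  fix I assume "two_sided_ideal (Ellis \<theta>) (compose X) I"
  then have I: "I \<noteq> {}" "I \<subseteq> Ellis \<theta>" "\<And>f i. f \<in> Ellis \<theta> \<Longrightarrow> i \<in> I \<Longrightarrow> compose X f i \<in> I"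
    "\<And>f i. f \<in> Ellis \<theta> \<Longrightarrow> i \<in> I \<Longrightarrow> compose X i f \<in> I"
    unfolding two_sided_ideal_def by blast+
  \<comment> \<open>For \<open>i \<in> I\<close> and \<open>p \<in> omega_limits s\<close>, the product \<open>i p\<close> identifies a nontrivial pair asymptotic in
    direction \<open>s\<close>, hence not in direction \<open>- s\<close>, so \<open>i p\<close> lies in \<open>omega_limits s\<close> as well.\<close>
  have "omega_limits s \<subseteq> I" if s: "s = 1 \<or> s = - 1" for s
  proof -
    obtain i where i: "i \<in> I" using I(1) by blast
    obtain p where p: "p \<in> omega_limits s" using omega_limits_nonempty[OF s] by blast
    have pE: "p \<in> Ellis \<theta>" using p omega_limits_subset_Ellis by blast
    have ip: "compose X i p \<in> I" using I(4)[OF pE i] .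
    have ipE: "compose X i p \<in> Ellis \<theta>" using ip I(2) by blast
    obtain x x' where x: "x \<in> X" "x' \<in> X" "x \<noteq> x'" "\<forall>i\<ge>0. x (s * i) = x' (s * i)"
      using ex_asymptotic_pair[OF s] by blast
    then have as: "asymptotic s x x'" unfolding asymptotic_def by blast
    have "p x = p x'" using omega_limits_eq_iff[OF s p x(1,2)] as by blast
    then have col: "compose X i p x = compose X i p x'" using x by (simp add: compose_def)
    then have "\<not> inj_on (compose X i p) X" using x unfolding inj_on_def by blast
    then have "compose X i p \<in> omega_limits 1 \<or> compose X i p \<in> omega_limits (- 1)"
      using Ellis_cases[OF ipE] by blast
    then have "compose X i p \<in> omega_limits s \<or> compose X i p \<in> omega_limits (- s)" using s by auto
    moreover have "compose X i p \<notin> omega_limits (- s)"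
    proof
      assume neg: "compose X i p \<in> omega_limits (- s)"
      have "- s = 1 \<or> - s = - 1" using s by auto
      then have "asymptotic (- s) x x'" using omega_limits_eq_iff[OF _ neg x(1,2)] col by blast
      then have "asymptotic 1 x x'" "asymptotic (- 1) x x'" using as s by auto
      then show False using two_sided_asymptotic_imp_eq[OF x(1,2)] x(3) by blast
    qed
    ultimately have ipd: "compose X i p \<in> omega_limits s" by blast
    show ?thesis
    proof
      fix f assume "f \<in> omega_limits s"
      then obtain h where "h \<in> omega_limits s" "f = compose X h (compose X i p)"
        using omega_limits_left_simple[OF s _ ipd] by blast
      then show "f \<in> I" using I(3) ip omega_limits_subset_Ellis by blast
    qed
  qed
  then show "?M \<subseteq> I" using Ellis_not_shift_omega_limits by blast
qed

section \<open>Proximality in an arbitrary compatible metric\<close>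

lemma metric_proximality:
  assumes d: "induces_subst_topology \<theta> d" and s: "s = 1 \<or> s = - 1"
  defines "D \<equiv> \<lambda>x x' (t::nat). d (shift (s * int t) x) (shift (s * int t) x')"
  shows "\<forall>x\<in>X. \<forall>x'\<in>X. (INF t. D x x' t) = 0 \<longrightarrow> D x x' \<longlonglongrightarrow> 0"
    and "{(x, x'). x \<in> X \<and> x' \<in> X \<and> (INF t. D x x' t) = 0} \<noteq> Id_on X"
proof -
  have ss: "s * s = 1" using s by auto
  show "\<forall>x\<in>X. \<forall>x'\<in>X. (INF t. D x x' t) = 0 \<longrightarrow> D x x' \<longlonglongrightarrow> 0"
  proof (intro ballI impI)
    fix x x' assume x: "x \<in> X" "x' \<in> X" and 0: "(INF t. D x x' t) = 0"
    have "proximal s x x'" using metric_proximal[OF d x 0[unfolded D_def]] .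
    then have "asymptotic s x x'" by (rule proximal_imp_asymptotic[OF x s])
    then show "D x x' \<longlonglongrightarrow> 0" unfolding D_def by (rule asymptotic_metric[OF d x ss])
  qed
  obtain x x' where x: "x \<in> X" "x' \<in> X" "x \<noteq> x'" "\<forall>i\<ge>0. x (s * i) = x' (s * i)"
    using ex_asymptotic_pair[OF s] by blast
  then have "asymptotic s x x'" unfolding asymptotic_def by blast
  then have 0: "(INF t. D x x' t) = 0" unfolding D_def by (rule asymptotic_metric_INF[OF d x(1,2) ss])
  show "{(x, x'). x \<in> X \<and> x' \<in> X \<and> (INF t. D x x' t) = 0} \<noteq> Id_on X"
  proof
    assume eq: "{(x, x'). x \<in> X \<and> x' \<in> X \<and> (INF t. D x x' t) = 0} = Id_on X"
    have "(x, x') \<in> {(x, x'). x \<in> X \<and> x' \<in> X \<and> (INF t. D x x' t) = 0}"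
      using x(1,2) 0 by simp
    then show False using x(3) unfolding eq by (simp add: Id_on_iff)
  qed
qed

end

theorem corollary4p3:
  fixes \<theta> :: "'a::finite \<Rightarrow> 'a list" and L :: nat
  assumes "2 \<le> L"
    and "constant_length \<theta> L"
    and "primitive_subst \<theta>"
    and "bijective_subst \<theta> L"
    and "aperiodic_subst \<theta>"
  shows
    "(\<forall>d. induces_subst_topology \<theta> d \<longrightarrow>
        (\<forall>x\<in>subst_space \<theta>. \<forall>x'\<in>subst_space \<theta>.
           (forward_proximal d x x' \<longrightarrow> forward_asymptotic d x x') \<and>
           (backward_proximal d x x' \<longrightarrow> backward_asymptotic d x x')) \<and>
        {(x, x'). x \<in> subst_space \<theta> \<and> x' \<in> subst_space \<theta> \<and> forward_proximal d x x'}
          \<noteq> Id_on (subst_space \<theta>) \<and>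
        {(x, x'). x \<in> subst_space \<theta> \<and> x' \<in> subst_space \<theta> \<and> backward_proximal d x x'}
          \<noteq> Id_on (subst_space \<theta>)) \<and>
     completely_regular_semigroup (Ellis \<theta>) (compose (subst_space \<theta>)) \<and>
     (\<exists>M. is_kernel (Ellis \<theta>) (compose (subst_space \<theta>)) M \<and>
          Ellis \<theta> = M \<union> shift_maps \<theta> \<and> M \<inter> shift_maps \<theta> = {})"
proof -
  interpret bijective_substitution \<theta> L
    using assms by unfold_locales
  have metric: "(\<forall>x\<in>X. \<forall>x'\<in>X.
           (forward_proximal d x x' \<longrightarrow> forward_asymptotic d x x') \<and>
           (backward_proximal d x x' \<longrightarrow> backward_asymptotic d x x')) \<and>
        {(x, x'). x \<in> X \<and> x' \<in> X \<and> forward_proximal d x x'} \<noteq> Id_on X \<and>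
        {(x, x'). x \<in> X \<and> x' \<in> X \<and> backward_proximal d x x'} \<noteq> Id_on X"
    if d: "induces_subst_topology \<theta> d" for d
    unfolding forward_proximal_def backward_proximal_def forward_asymptotic_def backward_asymptotic_def
    using metric_proximality[OF d, of 1] metric_proximality[OF d, of "- 1"] by simp
  show ?thesis
  proof (intro conjI allI impI)
    show "\<exists>M. is_kernel (Ellis \<theta>) (compose X) M \<and> Ellis \<theta> = M \<union> shift_maps \<theta> \<and> M \<inter> shift_maps \<theta> = {}"
      using kernel_Ellis shift_maps_subset_Ellis by (intro exI[of _ "Ellis \<theta> - shift_maps \<theta>"]) auto
  qed (use metric completely_regular_Ellis in blast)+
qed

end
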